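(* LFTJ-$\Delta$ (Leapfrog Triejoin applied to the triangle query) lists triangles in $O(|E|\log|E|)$ steps for planar graphs and for graphs with bounded degree.
   Context: **Input.** A simple undirected graph $G$ is represented by its directed version $G^\star=(V,E)$, where for each edge $\{a,b\}$ of $G$, $E$ contains the pair $(\min\{a,b\},\max\{a,b\})$. "Graphs with bounded degree" means: graphs whose maximum degree is at most a fixed constant. **LFTJ-$\Delta$** is the in-memory Leapfrog Triejoin run on the query $T(x,y,z)\leftarrow E(x,y),E(x,z),E(y,z)$ with variable order $x,y,z$. With $V_1=\{u:(u,v)\in E\}$ and $D(v)=\{u:(v,u)\in E\}$ it performs: for each $a\in V_1\cap V_1$, for each $b\in V_1\cap D(a)$, for each $c\in D(a)\cap D(b)$, output $(a,b,c)$. Each intersection of sorted sets is computed by a leapfrog join: one iterator per set, repeatedly moving (by a "seek") the iterator with the smallest value to the least element that is at least the largest current iterator value, reporting a value whenever all iterators agree, and stopping when an iterator passes its end. Reading the current value and testing for the end take $O(1)$ time; in a set of size $N$ a seek or next takes $O(\log N)$ time, and amortized $O(1+\log(N/k))$ time if $k$ keys are visited. Consequently a leapfrog join of sets with smallest size $N_{\min}$ and largest size $N_{\max}$ takes time $O(N_{\min}\log(N_{\max}/N_{\min}))$. *)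

theory Defs
  imports "HOL-Analysis.Analysis"
begin

section \<open>Graphs\<close>

text \<open>A graph is a vertex set together with a set of edges, each edge being a two-element set.\<close>

definition simple_graph :: "'a set \<Rightarrow> 'a set set \<Rightarrow> bool" where
  "simple_graph V G \<longleftrightarrow> finite V \<and> (\<forall>e\<in>G. e \<subseteq> V \<and> card e = 2)"

definition degree :: "'a set set \<Rightarrow> 'a \<Rightarrow> nat" where
  "degree G v = card {e \<in> G. v \<in> e}"

definition max_degree_le :: "nat \<Rightarrow> 'a set \<Rightarrow> 'a set set \<Rightarrow> bool" where
  "max_degree_le d V G \<longleftrightarrow> (\<forall>v\<in>V. degree G v \<le> d)"

text \<open>A graph is planar if it can be drawn in the plane without crossings: \<open>p\<close> places the vertices,
  \<open>\<gamma> e\<close> draws the edge \<open>e\<close> as a simple arc between its endpoints that avoids all other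
  vertices, and distinct edges meet at most in vertices.\<close>

definition planar :: "'a set \<Rightarrow> 'a set set \<Rightarrow> bool" where
  "planar V G \<longleftrightarrow> (\<exists>(p :: 'a \<Rightarrow> complex) (\<gamma> :: 'a set \<Rightarrow> real \<Rightarrow> complex).
     inj_on p V \<and>
     (\<forall>e\<in>G. arc (\<gamma> e) \<and> {pathstart (\<gamma> e), pathfinish (\<gamma> e)} = p ` e \<and>
            path_image (\<gamma> e) \<inter> p ` V = p ` e) \<and>
     (\<forall>e\<in>G. \<forall>f\<in>G. e \<noteq> f \<longrightarrow> path_image (\<gamma> e) \<inter> path_image (\<gamma> f) \<subseteq> p ` V))"

definition orient :: "'a::linorder set set \<Rightarrow> ('a \<times> 'a) set" where
  "orient G = (\<lambda>e. (Min e, Max e)) ` G"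

text \<open>Every triangle is listed exactly once, with its vertices in increasing order.\<close>

definition lists_triangles :: "('a::linorder \<times> 'a \<times> 'a) list \<Rightarrow> 'a set set \<Rightarrow> bool" where
  "lists_triangles out G \<longleftrightarrow> distinct out \<and>
     set out = {(a, b, c). a < b \<and> b < c \<and> {a, b} \<in> G \<and> {a, c} \<in> G \<and> {b, c} \<in> G}"


section \<open>Iterators over sorted sets\<close>

text \<open>The state of an iterator is the sorted list of the keys from the current one onwards;
  the empty list means that the iterator has passed its end.\<close>

datatype 'a iter_op = Next | Seek 'a

fun move :: "'a::linorder iter_op \<Rightarrow> 'a list \<Rightarrow> 'a list" where
  "move Next xs = tl xs"
| "move (Seek v) xs = dropWhile (\<lambda>x. x < v) xs"

text \<open>Sequences of operations that never start at the end and always leave the current key.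
  A seek that stays where it is visits no new key, so the amortized bound below would be
  unreasonable for sequences with such seeks.\<close>

fun advancing :: "'a::linorder list \<Rightarrow> 'a iter_op list \<Rightarrow> bool" where
  "advancing xs [] \<longleftrightarrow> True"
| "advancing [] (p # ps) \<longleftrightarrow> False"
| "advancing (x # xs) (p # ps) \<longleftrightarrow>
     (case p of Next \<Rightarrow> True | Seek v \<Rightarrow> x < v) \<and> advancing (move p (x # xs)) ps"

text \<open>The number of keys visited, including the initial one.\<close>

fun visited :: "'a::linorder list \<Rightarrow> 'a iter_op list \<Rightarrow> nat" where
  "visited [] ps = 0"
| "visited (x # xs) [] = 1"
| "visited (x # xs) (p # ps) = Suc (visited (move p (x # xs)) ps)"

text \<open>The implementation of seek and next is left open. It is represented by a function \<open>mt\<close>: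
  \<open>mt S ps\<close> is the number of steps taken by the last operation of the sequence \<open>ps\<close>
  if \<open>ps\<close> is performed on a fresh iterator over \<open>S\<close>.\<close>

type_synonym 'a move_time = "'a set \<Rightarrow> 'a iter_op list \<Rightarrow> nat"

definition run_time :: "'a move_time \<Rightarrow> 'a set \<Rightarrow> 'a iter_op list \<Rightarrow> nat" where
  "run_time mt S ps = (\<Sum>i = 1..length ps. mt S (take i ps))"

text \<open>In a set of size \<open>N\<close>, every seek or next takes time \<open>O(log N)\<close>, and
  amortized \<open>O(1 + log (N / k))\<close> if \<open>k\<close> keys are visited. The summand 1 in the first bound
  accounts for \<open>N = 1\<close>.\<close>

definition efficient_iterators :: "'a::linorder move_time \<Rightarrow> bool" where
  "efficient_iterators mt \<longleftrightarrow> (\<exists>c::real. \<forall>S ps.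
     finite S \<and> ps \<noteq> [] \<and> advancing (sorted_list_of_set S) ps \<longrightarrow>
       (let N = real (card S); k = real (visited (sorted_list_of_set S) ps) in
         real (mt S ps) \<le> c * (1 + log 2 N) \<and>
         real (run_time mt S ps) \<le> k * (c * (1 + log 2 (N / k)))))"


section \<open>Leapfrog join\<close>

text \<open>Leapfrog join of two iterators. The result consists of the reported values, the operations
  performed on the first and on the second iterator, and the number of unit steps other than
  seek and next. A round takes two end tests, two reads and one comparison of the
  values read; the last round stops at the first successful end test. After a match the first iterator
  is advanced by next.\<close>

function leapfrog :: "'a::linorder list \<Rightarrow> 'a list \<Rightarrow>
    'a list \<times> 'a iter_op list \<times> 'a iter_op list \<times> nat" where
  "leapfrog [] ys = ([], [], [], 1)"
| "leapfrog (x # xs) [] = ([], [], [], 2)"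
| "leapfrog (x # xs) (y # ys) =
     (if x = y then
        (let (out, ps, qs, n) = leapfrog (move Next (x # xs)) (y # ys)
         in (x # out, Next # ps, qs, 5 + n))
      else if x < y then
        (let (out, ps, qs, n) = leapfrog (move (Seek y) (x # xs)) (y # ys)
         in (out, Seek y # ps, qs, 5 + n))
      else
        (let (out, ps, qs, n) = leapfrog (x # xs) (move (Seek x) (y # ys))
         in (out, ps, Seek x # qs, 5 + n)))"
  by pat_completeness auto
termination
  by (relation "Wellfounded.measure (\<lambda>(xs, ys). length xs + length ys)")
     (auto simp: less_Suc_eq_le length_dropWhile_le)

text \<open>Opening the two iterators takes one step each.\<close>

definition leapfrog_join :: "'a::linorder move_time \<Rightarrow> 'a set \<Rightarrow> 'a set \<Rightarrow> 'a list \<times> nat" where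
  "leapfrog_join mt S T =
     (let (out, ps, qs, n) = leapfrog (sorted_list_of_set S) (sorted_list_of_set T)
      in (out, 2 + n + run_time mt S ps + run_time mt T qs))"


section \<open>Leapfrog Triejoin for the triangle query\<close>

text \<open>Loop over the intersection of \<open>S\<close> and \<open>T\<close>, with output and number of steps.\<close>

definition for_join :: "'a::linorder move_time \<Rightarrow> 'a set \<Rightarrow> 'a set \<Rightarrow>
    ('a \<Rightarrow> 'b list \<times> nat) \<Rightarrow> 'b list \<times> nat" where
  "for_join mt S T body =
     (let (keys, t) = leapfrog_join mt S T; results = map body keys
      in (concat (map fst results), t + sum_list (map snd results)))"

definition lftj_triangle :: "'a::linorder move_time \<Rightarrow> ('a \<times> 'a) set \<Rightarrow>
    ('a \<times> 'a \<times> 'a) list \<times> nat" where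
  "lftj_triangle mt E =
     (let V1 = Domain E; D = (\<lambda>v. E `` {v}) in
      for_join mt V1 V1 (\<lambda>a.
        for_join mt V1 (D a) (\<lambda>b.
          for_join mt (D a) (D b) (\<lambda>c. ([(a, b, c)], 1)))))"

abbreviation lftj_output :: "'a::linorder move_time \<Rightarrow> ('a \<times> 'a) set \<Rightarrow> ('a \<times> 'a \<times> 'a) list" where
  "lftj_output mt E \<equiv> fst (lftj_triangle mt E)"

abbreviation lftj_steps :: "'a::linorder move_time \<Rightarrow> ('a \<times> 'a) set \<Rightarrow> nat" where
  "lftj_steps mt E \<equiv> snd (lftj_triangle mt E)"

end

theory Submission
  imports Defs
begin

text \<open>A leapfrog join of \<open>S\<close> and \<open>T\<close> makes \<open>O(min |S| |T|)\<close> moves, so everything reduces to bounding the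
  sum of \<open>min (d a) (d b)\<close> over all edges by \<open>O(|E|)\<close>, where \<open>d\<close> is the out-degree. This is immediate for
  bounded degree. If every vertex set \<open>W\<close> spans at most \<open>k |W|\<close> edges, then summing over the
  layers \<open>{v. d v \<ge> t}\<close> gives the bound \<open>k |E|\<close>. Planar graphs have this property with \<open>k = 8\<close>: in a
  denser graph, three rounds of Mader's argument find a \<open>K_3_3\<close> minor, and drawing it in the plane
  would place a tripod in a face of a theta curve, with a foot on each of the three arcs.\<close>

section \<open>Theta curves\<close>

text \<open>The orientation follows the vertex order and not the shape of the graph, so a planar
  graph such as a star may have huge out-degrees; only the minimum over the two ends of an edge can
  be controlled, and only on average. Any constant will do for this, so the sharp edge bound of
  Euler's formula, which would require counting the faces of drawings by arbitrary arcs, can be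
  replaced by the exclusion of one minor. \<open>K_3_3\<close> suits this purpose: without one of
  its vertices it is a theta curve, and the Jordan curve theorem together with Janiszewski's theorem
  settles where the missing vertex could lie. The constant 8 is 2 * 2 * 2: each round of Mader's
  argument turns \<open>d\<close> edges per vertex into minimum degree \<open>d\<close> in the next
  set, and minimum degree \<open>d\<close> only guarantees \<open>d / 2\<close> edges per vertex for
  the round after it. The densities 8, 4, 2 leave a last set with minimum degree 2, just enough to
  contain three vertices.\<close>

definition theta_curve :: "complex \<Rightarrow> complex \<Rightarrow> (real \<Rightarrow> complex) \<Rightarrow> (real \<Rightarrow> complex) \<Rightarrow>
    (real \<Rightarrow> complex) \<Rightarrow> bool" where
  "theta_curve a b c1 c2 c3 \<longleftrightarrow>
     (\<forall>c\<in>{c1, c2, c3}. arc c \<and> pathstart c = a \<and> pathfinish c = b) \<and>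
     path_image c1 \<inter> path_image c2 = {a, b} \<and>
     path_image c1 \<inter> path_image c3 = {a, b} \<and>
     path_image c2 \<inter> path_image c3 = {a, b}"

lemma theta_curve_rotate: "theta_curve a b c1 c2 c3 \<Longrightarrow> theta_curve a b c2 c3 c1"
  unfolding theta_curve_def by blast

lemma theta_curve_Jordan:
  assumes "theta_curve a b c1 c2 c3"
  defines "J \<equiv> path_image c1 \<union> path_image c2"
  shows "inside J \<noteq> {}" "open (inside J)" "connected (inside J)" "bounded (inside J)"
    "connected (outside J)" "open (outside J)" "frontier (inside J) = J" "compact J"
proof -
  have c: "arc c1" "arc c2" "pathstart c1 = a" "pathfinish c1 = b" "pathstart c2 = a"
      "pathfinish c2 = b" "path_image c1 \<inter> path_image c2 = {a, b}"
    using assms unfolding theta_curve_def by auto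
  define g where "g = c1 +++ reversepath c2"
  have g: "simple_path g" "pathfinish g = pathstart g"
    unfolding g_def using c by (auto intro!: simple_path_join_loop simp: arc_reversepath)
  have gJ: "path_image g = J"
    unfolding g_def J_def using c by (simp add: path_image_join)
  show "inside J \<noteq> {}" "open (inside J)" "connected (inside J)" "bounded (inside J)"
    "connected (outside J)" "open (outside J)" "frontier (inside J) = J"
    using Jordan_inside_outside[OF g] unfolding gJ by auto
  show "compact J"
    using c by (simp add: J_def compact_Un compact_arc_image)
qed

text \<open>This tells apart two loops that share an arc: the midpoint of an arc differs from both
  ends by injectivity, hence lies on neither of the other arcs.\<close>

lemma theta_curve_interior_point:
  assumes "theta_curve a b c1 c2 c3"
  obtains z where "z \<in> path_image c1" "z \<notin> path_image c2" "z \<notin> path_image c3"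
proof
  have c: "arc c1" "pathstart c1 = a" "pathfinish c1 = b"
      "path_image c1 \<inter> path_image c2 = {a, b}" "path_image c1 \<inter> path_image c3 = {a, b}"
    using assms unfolding theta_curve_def by auto
  have "inj_on c1 {0..1}" using c unfolding arc_def by blast
  then have "c1 (1/2) \<noteq> c1 0" "c1 (1/2) \<noteq> c1 1"
    by (force dest: inj_onD)+
  then have "c1 (1/2) \<notin> {a, b}"
    using c by (auto simp: pathstart_def pathfinish_def)
  moreover show "c1 (1/2) \<in> path_image c1" by (auto simp: path_image_def)
  ultimately show "c1 (1/2) \<notin> path_image c2" "c1 (1/2) \<notin> path_image c3"
    using c by blast+
qed

text \<open>Otherwise \<open>Y\<close> would meet both \<open>inside S\<close> and its complement,
  hence the frontier of \<open>inside S\<close>, hence \<open>S\<close>.\<close>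

lemma connected_subset_inside:
  assumes "connected Y" "Y \<inter> S = {}" "Y \<inter> inside S \<noteq> {}" "frontier (inside S) \<subseteq> S"
  shows "Y \<subseteq> inside S"
  using connected_Int_frontier[of Y "inside S"] assms by blast

text \<open>If every open arc ran outside the loop formed by the other two, the three insides would be
  disjoint; by Janiszewski's theorem two of the closed discs then do not separate the plane,
  although their union contains the third loop.\<close>

lemma theta_curve_arc_inside:
  assumes \<theta>: "theta_curve a b c1 c2 c3"
  shows "path_image c1 \<inter> inside (path_image c2 \<union> path_image c3) \<noteq> {} \<or>
         path_image c2 \<inter> inside (path_image c3 \<union> path_image c1) \<noteq> {} \<or>
         path_image c3 \<inter> inside (path_image c1 \<union> path_image c2) \<noteq> {}"
proof (rule ccontr)
  note \<theta>2 = theta_curve_rotate[OF \<theta>] and \<theta>3 = theta_curve_rotate[OF theta_curve_rotate[OF \<theta>]]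
  let ?P = path_image
  define I12 where "I12 = inside (?P c1 \<union> ?P c2)"
  define I23 where "I23 = inside (?P c2 \<union> ?P c3)"
  define I31 where "I31 = inside (?P c3 \<union> ?P c1)"
  note J12 = theta_curve_Jordan[OF \<theta>, folded I12_def]
   and J23 = theta_curve_Jordan[OF \<theta>2, folded I23_def]
   and J31 = theta_curve_Jordan[OF \<theta>3, folded I31_def]
  assume "\<not> ?thesis"
  then have out: "?P c1 \<inter> I23 = {}" "?P c2 \<inter> I31 = {}" "?P c3 \<inter> I12 = {}"
    by (auto simp: I12_def I23_def I31_def)
  have on: "?P c1 \<inter> I12 = {}" "?P c2 \<inter> I12 = {}" "?P c2 \<inter> I23 = {}" "?P c3 \<inter> I23 = {}"
    "?P c3 \<inter> I31 = {}" "?P c1 \<inter> I31 = {}"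
    using inside_no_overlap unfolding I12_def I23_def I31_def by blast+
  \<comment> \<open>If two such insides met, each would be a connected set missing the loop of the
    other, so they would coincide. Equal frontiers then make the loops equal, although inner points
    of \<open>u\<close> lie on the first loop only.\<close>
  have disj: "inside (?P u \<union> ?P v) \<inter> inside (?P v \<union> ?P w) = {}"
    if t: "theta_curve a b u v w" and o: "?P w \<inter> inside (?P u \<union> ?P v) = {}"
      "?P u \<inter> inside (?P v \<union> ?P w) = {}" for u v w
  proof (rule ccontr)
    note J = theta_curve_Jordan[OF t] theta_curve_Jordan[OF theta_curve_rotate[OF t]]
    assume ne: "\<not> ?thesis"
    have "inside (?P u \<union> ?P v) \<subseteq> inside (?P v \<union> ?P w)"
    proof (rule connected_subset_inside)
      show "inside (?P u \<union> ?P v) \<inter> (?P v \<union> ?P w) = {}"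
        using o inside_no_overlap[of "?P u \<union> ?P v"] by blast
    qed (use J ne in auto)
    moreover have "inside (?P v \<union> ?P w) \<subseteq> inside (?P u \<union> ?P v)"
    proof (rule connected_subset_inside)
      show "inside (?P v \<union> ?P w) \<inter> (?P u \<union> ?P v) = {}"
        using o inside_no_overlap[of "?P v \<union> ?P w"] by blast
    qed (use J ne in auto)
    ultimately have "?P u \<union> ?P v = ?P v \<union> ?P w"
      using J(7,15) by (metis subset_antisym)
    then show False
      using theta_curve_interior_point[OF t] by blast
  qed
  have d: "I12 \<inter> I23 = {}" "I23 \<inter> I31 = {}" "I31 \<inter> I12 = {}"
    using disj[OF \<theta>] disj[OF \<theta>2] disj[OF \<theta>3] out by (auto simp: I12_def I23_def I31_def)
  define D12 where "D12 = ?P c1 \<union> ?P c2 \<union> I12"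
  define D23 where "D23 = ?P c2 \<union> ?P c3 \<union> I23"
  have co: "- D12 = outside (?P c1 \<union> ?P c2)" "- D23 = outside (?P c2 \<union> ?P c3)"
    unfolding D12_def D23_def I12_def I23_def by (auto simp: outside_inside)
  have compD: "compact D12" "compact D23"
  proof -
    have "closed D12" "closed D23"
      using J12(6) J23(6) co by (metis closed_def)+
    moreover have "bounded D12" "bounded D23"
      using J12(4) J12(8)[THEN compact_imp_bounded] J23(4) J23(8)[THEN compact_imp_bounded]
      unfolding D12_def D23_def by (simp_all only: bounded_Un)
    ultimately show "compact D12" "compact D23"
      by (auto simp: compact_eq_bounded_closed)
  qed
  \<comment> \<open>Janiszewski's theorem asks for a connected intersection. Off \<open>c2\<close>
    the two discs share nothing: \<open>c1\<close> and \<open>c3\<close> avoid the opposite insides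
    and meet only in the ends, which lie on \<open>c2\<close>.\<close>
  have "?P c1 \<inter> ?P c3 \<subseteq> ?P c2"
    using \<theta> unfolding theta_curve_def by blast
  then have "D12 \<inter> D23 = ?P c2"
    using out(1,3) d(1) unfolding D12_def D23_def by fast
  moreover have "connected (?P c2)"
    using \<theta> by (auto simp: theta_curve_def intro: connected_arc_image)
  ultimately have conK: "connected (- (D12 \<union> D23))"
    using compD J12(5) J23(5) by (intro Janiszewski_connected) (auto simp: co compact_imp_closed)
  \<comment> \<open>The loop of \<open>c3\<close> and \<open>c1\<close> lies in the union, so the
    connected complement stays on one side of it. It contains points of \<open>I31\<close>, hence is
    bounded, and then so is the whole plane.\<close>
  have "- (D12 \<union> D23) \<subseteq> I31"
    unfolding I31_def
  proof (rule connected_subset_inside[OF conK])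
    show "- (D12 \<union> D23) \<inter> (?P c3 \<union> ?P c1) = {}"
      by (auto simp: D12_def D23_def)
    have "I31 \<inter> (D12 \<union> D23) = {}"
      using d(2,3) on(5,6) out(2) unfolding D12_def D23_def by fast
    then show "- (D12 \<union> D23) \<inter> inside (?P c3 \<union> ?P c1) \<noteq> {}"
      using J31(1) unfolding I31_def by blast
  qed (use J31 in \<open>auto simp: I31_def\<close>)
  then have "bounded (- (D12 \<union> D23))"
    using J31(4) bounded_subset by blast
  then have "bounded ((D12 \<union> D23) \<union> - (D12 \<union> D23))"
    using compD[THEN compact_imp_bounded] by (simp only: bounded_Un)
  then show False
    by (simp only: Compl_partition not_bounded_UNIV)
qed

text \<open>The open arc \<open>c3\<close> cuts the inside of the loop of \<open>c1\<close> and
  \<open>c2\<close> into two regions. Being connected, \<open>Y\<close> falls into one of them, and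
  the closure of that region misses the open arc on the far side.\<close>

lemma theta_curve_no_common_face_inside:
  assumes \<theta>: "theta_curve a b c1 c2 c3"
    and ins: "path_image c3 \<inter> inside (path_image c1 \<union> path_image c2) \<noteq> {}"
    and Y: "connected Y" "Y \<inter> (path_image c1 \<union> path_image c2 \<union> path_image c3) = {}"
    and cl: "closure Y \<inter> (path_image c1 - {a, b}) \<noteq> {}"
      "closure Y \<inter> (path_image c2 - {a, b}) \<noteq> {}" "closure Y \<inter> (path_image c3 - {a, b}) \<noteq> {}"
  shows False
proof -
  let ?P = path_image
  note t = \<theta>[unfolded theta_curve_def]
  have ab: "a \<noteq> b"
    using t arc_distinct_ends by force
  have eq: "inside (?P c1 \<union> ?P c3) \<union> inside (?P c2 \<union> ?P c3) \<union> (?P c3 - {a,b})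
      = inside (?P c1 \<union> ?P c2)"
    using split_inside_simple_closed_curve[of c1 a b c2 c3] t ab ins by (auto simp: arc_imp_simple_path)
  have no_side: False if v: "theta_curve a b u w v" and meet: "Y \<inter> inside (?P u \<union> ?P v) \<noteq> {}"
      and sub: "inside (?P u \<union> ?P v) \<subseteq> inside (?P u \<union> ?P w)" and cw: "closure Y \<inter> (?P w - {a, b}) \<noteq> {}"
      and Yuv: "Y \<inter> (?P u \<union> ?P v) = {}" for u v w
  proof -
    have v': "theta_curve a b u v w" using v unfolding theta_curve_def by blast
    note J = theta_curve_Jordan[OF v']
    have "Y \<subseteq> inside (?P u \<union> ?P v)"
      using J by (intro connected_subset_inside Y meet Yuv) auto
    then have "closure Y \<subseteq> inside (?P u \<union> ?P v) \<union> (?P u \<union> ?P v)"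
      by (metis J(8) closure_inside_subset closure_mono compact_imp_closed order_trans sup_commute)
    \<comment> \<open>A point of the open arc \<open>w\<close> in \<open>closure Y\<close> is on
      neither \<open>u\<close> nor \<open>v\<close>, so it lies inside their loop, and by
      \<open>sub\<close> inside the loop of \<open>u\<close> and \<open>w\<close>, to which it
      belongs.\<close>
    moreover have "(?P w - {a, b}) \<inter> (?P u \<union> ?P v) = {}"
      using v unfolding theta_curve_def by blast
    ultimately have "(?P w - {a, b}) \<inter> inside (?P u \<union> ?P w) \<noteq> {}"
      using cw sub by blast
    then show False
      using inside_no_overlap[of "?P u \<union> ?P w"] by blast
  qed
  \<comment> \<open>\<open>closure Y\<close> meets the open arc \<open>c3\<close>, which by
    \<open>eq\<close> lies inside the loop; since the inside is open, \<open>Y\<close> itself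
    reaches into it.\<close>
  have "closure Y \<inter> inside (?P c1 \<union> ?P c2) \<noteq> {}"
    using cl(3) eq by blast
  then have "Y \<inter> inside (?P c1 \<union> ?P c2) \<noteq> {}"
    using theta_curve_Jordan(2)[OF \<theta>] open_Int_closure_eq_empty by blast
  then consider "Y \<inter> inside (?P c1 \<union> ?P c3) \<noteq> {}" | "Y \<inter> inside (?P c2 \<union> ?P c3) \<noteq> {}"
    using eq Y(2) by blast
  then show False
  proof cases
    case 1
    have "theta_curve a b c1 c2 c3" by (rule \<theta>)
    then show False
      by (rule no_side[of c1 c2 c3]) (use 1 eq cl Y in blast)+
  next
    case 2
    have "theta_curve a b c2 c1 c3" using \<theta> unfolding theta_curve_def by blast
    then show False
      by (rule no_side[of c2 c1 c3]) (use 2 eq[unfolded Un_commute[of "path_image c1" "path_image c2"]] cl Y in blast)+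
  qed
qed

text \<open>Some arc runs inside the loop of the other two, and the assumptions on \<open>Y\<close>
  are symmetric in the arcs, so a rotation makes it the third one.\<close>

proposition theta_curve_no_common_face:
  assumes \<theta>: "theta_curve a b c1 c2 c3"
    and Y: "connected Y" "Y \<inter> (path_image c1 \<union> path_image c2 \<union> path_image c3) = {}"
    and cl: "closure Y \<inter> (path_image c1 - {a, b}) \<noteq> {}"
      "closure Y \<inter> (path_image c2 - {a, b}) \<noteq> {}" "closure Y \<inter> (path_image c3 - {a, b}) \<noteq> {}"
  shows False
proof -
  note \<theta>2 = theta_curve_rotate[OF \<theta>] and \<theta>3 = theta_curve_rotate[OF theta_curve_rotate[OF \<theta>]]
  have Y': "Y \<inter> (path_image c2 \<union> path_image c3 \<union> path_image c1) = {}"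
    "Y \<inter> (path_image c3 \<union> path_image c1 \<union> path_image c2) = {}"
    using Y(2) by blast+
  from theta_curve_arc_inside[OF \<theta>] show False
    using theta_curve_no_common_face_inside[OF \<theta> _ Y cl]
      theta_curve_no_common_face_inside[OF \<theta>2 _ Y(1) Y'(1) cl(2,3,1)]
      theta_curve_no_common_face_inside[OF \<theta>3 _ Y(1) Y'(2) cl(3,1,2)] by blast
qed

text \<open>Each \<open>T\<close> leaves the face of \<open>x\<close> through its frontier, hence through \<open>c\<close>.\<close>

lemma theta_curve_no_tripod:
  assumes \<theta>: "theta_curve a b c1 c2 c3"
    and x: "x \<notin> path_image c1 \<union> path_image c2 \<union> path_image c3"
    and T: "\<And>c. c \<in> {c1, c2, c3} \<Longrightarrow> \<exists>T. connected T \<and> x \<in> T \<and> T \<inter> path_image c \<noteq> {} \<and>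
      T \<inter> (path_image c1 \<union> path_image c2 \<union> path_image c3) \<subseteq> path_image c - {a, b}"
  shows False
proof -
  define \<Theta> where "\<Theta> = path_image c1 \<union> path_image c2 \<union> path_image c3"
  define Y where "Y = connected_component_set (- \<Theta>) x"
  have "closed \<Theta>"
    using \<theta> by (auto simp: \<Theta>_def theta_curve_def closed_Un closed_arc_image)
  then have fr: "frontier Y \<subseteq> \<Theta>"
    using frontier_of_connected_component_subset[of "- \<Theta>" x] frontier_subset_closed
    unfolding Y_def by (metis frontier_complement order_trans)
  have xY: "x \<in> Y"
    using x by (simp add: Y_def \<Theta>_def)
  have YT: "Y \<inter> \<Theta> = {}"
    using connected_component_subset[of "- \<Theta>" x] unfolding Y_def by blast
  have cl: "closure Y \<inter> (path_image c - {a, b}) \<noteq> {}" if "c \<in> {c1, c2, c3}" for c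
  proof -
    obtain T where "connected T" "x \<in> T" "T \<inter> path_image c \<noteq> {}" "T \<inter> \<Theta> \<subseteq> path_image c - {a, b}"
      using T[OF \<open>c \<in> _\<close>] unfolding \<Theta>_def by blast
    moreover have "path_image c \<subseteq> \<Theta>" using that by (auto simp: \<Theta>_def)
    ultimately have "T \<inter> frontier Y \<noteq> {}"
      using xY YT by (intro connected_Int_frontier) blast+
    then show ?thesis
      using fr \<open>T \<inter> \<Theta> \<subseteq> _\<close> unfolding frontier_def by blast
  qed
  show False
    by (rule theta_curve_no_common_face[OF \<theta>, of Y])
       (use YT cl in \<open>auto simp: Y_def \<Theta>_def\<close>)
qed


section \<open>Sparsity of planar graphs\<close>

definition edges_in :: "'a set set \<Rightarrow> 'a set \<Rightarrow> 'a set set" where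
  "edges_in G W = {e \<in> G. e \<subseteq> W}"

definition nbrs :: "'a set set \<Rightarrow> 'a set \<Rightarrow> 'a set \<Rightarrow> 'a set" where
  "nbrs G W U = {w \<in> W - U. \<exists>u\<in>U. {u, w} \<in> G}"

text \<open>Connectedness is encoded as growth by one vertex along one edge: Mader's argument
  extends \<open>U\<close> in this way, and a drawing visibly stays path connected under it.\<close>

inductive connected_in :: "'a set set \<Rightarrow> 'a set \<Rightarrow> bool" for G where
  singleton: "connected_in G {v}"
| insert: "connected_in G U \<Longrightarrow> u \<in> U \<Longrightarrow> {u, w} \<in> G \<Longrightarrow> connected_in G (insert w U)"

lemma finite_edges_in: "finite W \<Longrightarrow> finite (edges_in G W)"
  by (rule finite_subset[of _ "Pow W"]) (auto simp: edges_in_def)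

lemma degree_edges_in:
  assumes G: "\<forall>e\<in>G. card e = 2" and "v \<in> W"
  shows "degree (edges_in G W) v = card (nbrs G W {v})"
proof -
  have "{e \<in> edges_in G W. v \<in> e} = (\<lambda>w. {v, w}) ` nbrs G W {v}"
  proof (intro set_eqI iffI)
    fix e assume "e \<in> {e \<in> edges_in G W. v \<in> e}"
    then have e: "e \<in> G" "e \<subseteq> W" "v \<in> e" "card e = 2" using G by (auto simp: edges_in_def)
    then obtain w where "w \<noteq> v" "e = {v, w}"
      by (metis card_2_iff doubleton_eq_iff insertE singletonD)
    then show "e \<in> (\<lambda>w. {v, w}) ` nbrs G W {v}"
      using e by (auto simp: nbrs_def)
  qed (use \<open>v \<in> W\<close> in \<open>auto simp: edges_in_def nbrs_def\<close>)
  moreover have "inj_on (\<lambda>w. {v, w}) (nbrs G W {v})"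
    by (auto simp: inj_on_def doubleton_eq_iff)
  ultimately show ?thesis by (simp add: degree_def card_image)
qed

lemma card_edges_in_remove:
  assumes G: "\<forall>e\<in>G. card e = 2" and "v \<in> W" "finite W"
  shows "card (edges_in G W) = card (edges_in G (W - {v})) + card (nbrs G W {v})"
proof -
  have "edges_in G W = edges_in G (W - {v}) \<union> {e \<in> edges_in G W. v \<in> e}"
    by (auto simp: edges_in_def)
  moreover have "edges_in G (W - {v}) \<inter> {e \<in> edges_in G W. v \<in> e} = {}"
    by (auto simp: edges_in_def)
  ultimately have "card (edges_in G W) = card (edges_in G (W - {v})) + degree (edges_in G W) v"
    using finite_edges_in[OF \<open>finite W\<close>, of G] finite_edges_in[of "W - {v}" G] \<open>finite W\<close>
    unfolding degree_def by (metis (no_types, lifting) card_Un_disjoint finite_Diff finite_Un)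
  then show ?thesis using degree_edges_in[OF G \<open>v \<in> W\<close>] by simp
qed

lemma handshake:
  assumes G: "\<forall>e\<in>G. card e = 2" and "finite W"
  shows "(\<Sum>v\<in>W. degree (edges_in G W) v) = 2 * card (edges_in G W)"
  unfolding degree_def
proof (rule sum_multicount)
  have "{v \<in> W. v \<in> e} = e" if "e \<in> edges_in G W" for e
    using that by (auto simp: edges_in_def)
  then show "\<forall>e\<in>edges_in G W. card {v \<in> W. v \<in> e} = 2"
    using G by (simp add: edges_in_def)
qed (use assms finite_edges_in in auto)

text \<open>Mader's argument: \<open>U\<close> is a maximal connected set whose contraction, inside a minimal dense
  subgraph, keeps at least \<open>d\<close> edges per vertex.\<close>

lemma dense_neighbourhood:
  assumes G: "\<forall>e\<in>G. card e = 2" and W: "finite W" "W \<noteq> {}" and "d > 0"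
    and dense: "card (edges_in G W) \<ge> d * card W"
  obtains U H where "connected_in G U" "U \<subseteq> W" "H \<subseteq> nbrs G W U" "H \<noteq> {}"
    "\<And>w. w \<in> H \<Longrightarrow> degree (edges_in G H) w \<ge> d"
proof -
  define Q where "Q X \<longleftrightarrow> X \<subseteq> W \<and> X \<noteq> {} \<and> d * card X \<le> card (edges_in G X)" for X
  have "Q W" using assms by (auto simp: Q_def)
  then obtain X where X: "Q X" and least: "\<And>Y. Q Y \<Longrightarrow> card X \<le> card Y"
    using ex_has_least_nat[of Q W card] by blast
  have finX: "finite X" and XW: "X \<subseteq> W" using X W finite_subset by (auto simp: Q_def)
  \<comment> \<open>Minimality of \<open>X\<close> is what makes \<open>H\<close> non-empty at the
    end: no smaller part of \<open>X\<close> reaches the density by itself.\<close>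
  then have min: "card (edges_in G Y) < d * card Y" if "Y \<subset> X" "Y \<noteq> {}" for Y
  proof -
    have "card Y < card X"
      using that finX by (simp add: psubset_card_mono)
    then have "\<not> Q Y" using least by (meson leD)
    then show ?thesis using that XW by (auto simp: Q_def)
  qed
  \<comment> \<open>Contracting \<open>U\<close> leaves \<open>card (X - U) + 1\<close> vertices,
    and the contracted vertex has one edge to each element of \<open>nbrs G X U\<close>.\<close>
  define P where "P U \<longleftrightarrow> connected_in G U \<and> U \<subseteq> X \<and> U \<noteq> {} \<and>
    d * (card (X - U) + 1) \<le> card (edges_in G (X - U)) + card (nbrs G X U)" for U
  obtain v where v: "v \<in> X" using X by (auto simp: Q_def)
  have "card (X - {v}) + 1 = card X" using v finX by (metis Suc_eq_plus1 card_Suc_Diff1)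
  then have "P {v}"
    using card_edges_in_remove[OF G v finX] X v
    by (auto simp: P_def Q_def connected_in.singleton simp del: One_nat_def)
  moreover have "card U \<le> card X" if "P U" for U
    using that finX by (auto simp: P_def card_mono)
  ultimately obtain U where U: "P U" and max: "\<And>U'. P U' \<Longrightarrow> card U' \<le> card U"
    using ex_has_greatest_nat[of P "{v}" card "Suc (card X)"] by (metis le_imp_less_Suc)
  define H where "H = nbrs G X U"
  have finU: "finite U" using U finX finite_subset by (auto simp: P_def)
  have finH: "finite H" using finX by (auto simp: H_def nbrs_def)
  have "degree (edges_in G H) w \<ge> d" if w: "w \<in> H" for w
  proof -
    have w': "w \<in> X" "w \<notin> U" using w by (auto simp: H_def nbrs_def)
    obtain u where u: "u \<in> U" "{u, w} \<in> G" using w by (auto simp: H_def nbrs_def)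
    \<comment> \<open>Contracting \<open>w\<close> into \<open>U\<close> as well costs one vertex,
      the edge between them, and one edge for every common neighbour, that is, for every element of
      \<open>N\<close> in \<open>H\<close>. By maximality of \<open>U\<close> this loses more than
      \<open>d\<close> edges, so there are at least \<open>d\<close> common neighbours.\<close>
    have "\<not> P (insert w U)"
      using max[of "insert w U"] w' finU by auto
    then have "card (edges_in G (X - insert w U)) + card (nbrs G X (insert w U))
        < d * (card (X - insert w U) + 1)"
      using connected_in.insert[of G U u w] U u w' unfolding P_def by auto
    moreover have XU: "X - insert w U = X - U - {w}" by blast
    moreover have "card (X - U - {w}) + 1 = card (X - U)"
      using w' finX by (metis DiffI Suc_eq_plus1 card_Suc_Diff1 finite_Diff)
    ultimately have less: "card (edges_in G (X - U - {w})) + card (nbrs G X (insert w U))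
        < d * card (X - U)"
      by (simp only:)
    define N where "N = nbrs G (X - U) {w}"
    have finN: "finite N" using finX by (auto simp: N_def nbrs_def)
    have "nbrs G X (insert w U) = (H - {w}) \<union> (N - H)"
      using w' by (auto simp: nbrs_def H_def N_def)
    then have "card (nbrs G X (insert w U)) = card (H - {w}) + card (N - H)"
      using finH finN by (metis Diff_disjoint Diff_subset Int_Diff card_Un_disjoint disjoint_iff
        finite_Diff inf_commute)
    moreover have "card (H - {w}) + 1 = card H"
      using w finH by (metis Suc_eq_plus1 card_Suc_Diff1)
    moreover have "card (edges_in G (X - U)) = card (edges_in G (X - U - {w})) + card N"
      unfolding N_def using card_edges_in_remove[OF G, of w "X - U"] w' finX by simp
    moreover have "card N = card (N \<inter> H) + card (N - H)"
      using finN by (simp add: card_Int_Diff)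
    moreover have "d * (card (X - U) + 1) \<le> card (edges_in G (X - U)) + card H"
      using U by (simp add: P_def H_def)
    ultimately have "d \<le> card (N \<inter> H)"
      using less by simp
    moreover have "N \<inter> H = nbrs G H {w}"
      by (auto simp: N_def H_def nbrs_def)
    ultimately show ?thesis
      using degree_edges_in[OF G w] by simp
  qed
  \<comment> \<open>With an isolated contracted vertex, \<open>X - U\<close> alone would reach the
    density, against minimality; if \<open>X - U\<close> is empty, there are no edges at all,
    against \<open>d > 0\<close>.\<close>
  moreover have "H \<noteq> {}"
  proof
    assume "H = {}"
    then have le: "d * (card (X - U) + 1) \<le> card (edges_in G (X - U))"
      using U by (simp add: P_def H_def)
    show False
    proof (cases "X - U = {}")
      case True
      then have "edges_in G (X - U) \<subseteq> {{}}" by (auto simp: edges_in_def)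
      moreover have "{} \<notin> G" using G by force
      ultimately have "edges_in G (X - U) = {}" by (auto simp: edges_in_def)
      then show False using le \<open>d > 0\<close> by simp
    next
      case False
      then show False using min[of "X - U"] U le by (auto simp: P_def)
    qed
  qed
  ultimately show thesis
    using that[of U H] U XW by (auto simp: P_def H_def nbrs_def)
qed

lemma dense_of_min_degree:
  assumes G: "\<forall>e\<in>G. card e = 2" and "finite H"
    and "\<And>w. w \<in> H \<Longrightarrow> degree (edges_in G H) w \<ge> 2 * d"
  shows "card (edges_in G H) \<ge> d * card H"
  using sum_bounded_below[of H "2 * d" "degree (edges_in G H)"] handshake[OF G, of H] assms
  by (simp add: mult.commute)

text \<open>A minor \<open>K_3_3\<close> in which one side consists of single vertices.\<close>

definition K33_minor :: "'a set set \<Rightarrow> 'a \<Rightarrow> 'a \<Rightarrow> 'a \<Rightarrow> (nat \<Rightarrow> 'a set) \<Rightarrow> bool" where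
  "K33_minor G a b c U \<longleftrightarrow> a \<noteq> b \<and> a \<noteq> c \<and> b \<noteq> c \<and>
     (\<forall>i<3. connected_in G (U i) \<and> U i \<inter> {a, b, c} = {} \<and> (\<forall>v\<in>{a, b, c}. \<exists>u\<in>U i. {u, v} \<in> G)) \<and>
     (\<forall>i<3. \<forall>j<3. i \<noteq> j \<longrightarrow> U i \<inter> U j = {})"

text \<open>Each round works inside the neighbourhood found by the previous one, so
  \<open>U1\<close>, \<open>U2\<close>, \<open>U3\<close> are disjoint and every vertex of
  \<open>H3\<close> has a neighbour in all three. Any three vertices of \<open>H3\<close> then form
  the other side.\<close>

lemma dense_imp_K33_minor:
  assumes G: "\<forall>e\<in>G. card e = 2" and W: "finite W" "W \<noteq> {}"
    and dense: "card (edges_in G W) \<ge> 8 * card W"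
  obtains a b c U where "K33_minor G a b c U" "{a, b, c} \<subseteq> W" "\<And>i. i < 3 \<Longrightarrow> U i \<subseteq> W"
proof -
  obtain U1 H1 where 1: "connected_in G U1" "U1 \<subseteq> W" "H1 \<subseteq> nbrs G W U1" "H1 \<noteq> {}"
    "\<And>w. w \<in> H1 \<Longrightarrow> degree (edges_in G H1) w \<ge> 8"
    using dense_neighbourhood[OF G W _ dense] by auto
  have f1: "finite H1" using 1(3) W(1) finite_subset by (fastforce simp: nbrs_def)
  obtain U2 H2 where 2: "connected_in G U2" "U2 \<subseteq> H1" "H2 \<subseteq> nbrs G H1 U2" "H2 \<noteq> {}"
    "\<And>w. w \<in> H2 \<Longrightarrow> degree (edges_in G H2) w \<ge> 4"
    using dense_neighbourhood[OF G f1 1(4), of 4] dense_of_min_degree[OF G f1, of 4] 1(5) by auto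
  have f2: "finite H2" using 2(3) f1 finite_subset by (fastforce simp: nbrs_def)
  obtain U3 H3 where 3: "connected_in G U3" "U3 \<subseteq> H2" "H3 \<subseteq> nbrs G H2 U3" "H3 \<noteq> {}"
    "\<And>w. w \<in> H3 \<Longrightarrow> degree (edges_in G H3) w \<ge> 2"
    using dense_neighbourhood[OF G f2 2(4), of 2] dense_of_min_degree[OF G f2, of 2] 2(5) by auto
  obtain a where a: "a \<in> H3" using 3 by blast
  then have "card (nbrs G H3 {a}) \<ge> 2"
    using degree_edges_in[OF G a] 3(5)[OF a] by metis
  then obtain N where "N \<subseteq> nbrs G H3 {a}" "card N = 2"
    by (meson obtain_subset_with_card_n)
  then obtain b c where bc: "b \<noteq> c" "{b, c} \<subseteq> nbrs G H3 {a}"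
    by (metis card_2_iff)
  define U where "U = (\<lambda>i::nat. if i = 0 then U1 else if i = 1 then U2 else U3)"
  have abc: "{a, b, c} \<subseteq> H3" "a \<noteq> b" "a \<noteq> c" using a bc by (auto simp: nbrs_def)
  have H1: "H1 \<subseteq> W" "H1 \<inter> U1 = {}" "\<And>w. w \<in> H1 \<Longrightarrow> \<exists>u\<in>U1. {u, w} \<in> G"
    using 1(3) by (auto simp: nbrs_def)
  have H2: "H2 \<subseteq> H1" "H2 \<inter> U2 = {}" "\<And>w. w \<in> H2 \<Longrightarrow> \<exists>u\<in>U2. {u, w} \<in> G"
    using 2(3) by (auto simp: nbrs_def)
  have H3: "H3 \<subseteq> H2" "H3 \<inter> U3 = {}" "\<And>w. w \<in> H3 \<Longrightarrow> \<exists>u\<in>U3. {u, w} \<in> G"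
    using 3(3) by (auto simp: nbrs_def)
  have sub: "H3 \<subseteq> H2" "H3 \<subseteq> H1" "U2 \<subseteq> W" "U3 \<subseteq> W"
    using H1(1) H2(1) H3(1) 2(2) 3(2) by blast+
  have branch: "X \<inter> {a, b, c} = {} \<and> (\<forall>v\<in>{a, b, c}. \<exists>u\<in>X. {u, v} \<in> G)"
    if "H3 \<subseteq> H" "H \<inter> X = {}" "\<And>w. w \<in> H \<Longrightarrow> \<exists>u\<in>X. {u, w} \<in> G" for X H
    using that(1,2) that(3)[of a] that(3)[of b] that(3)[of c] abc(1) by blast
  define Q where "Q X \<longleftrightarrow> connected_in G X \<and> X \<inter> {a, b, c} = {} \<and>
    (\<forall>v\<in>{a, b, c}. \<exists>u\<in>X. {u, v} \<in> G) \<and> X \<subseteq> W" for X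
  have "Q U1" "Q U2" "Q U3"
    unfolding Q_def using branch[OF sub(2) H1(2,3)] branch[OF sub(1) H2(2,3)]
      branch[OF order_refl H3(2,3)] 1(1,2) 2(1) 3(1) sub(3,4) by blast+
  then have "\<forall>i<3. Q (U i)"
    by (simp add: U_def)
  moreover have "U1 \<inter> U2 = {}" "U1 \<inter> U3 = {}" "U2 \<inter> U3 = {}"
    using H1(2) H2(1,2) 2(2) 3(2) by blast+
  then have "\<forall>i<3. \<forall>j<3. i \<noteq> j \<longrightarrow> U i \<inter> U j = {}"
    by (auto simp: U_def numeral_3_eq_3 less_Suc_eq)
  ultimately have "K33_minor G a b c U"
    using abc(2,3) bc(1) unfolding K33_minor_def Q_def by simp
  moreover have "{a, b, c} \<subseteq> W"
    using abc(1) H1(1) H2(1) H3(1) by order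
  moreover have "\<And>i. i < 3 \<Longrightarrow> U i \<subseteq> W"
    using \<open>\<forall>i<3. Q (U i)\<close> by (simp add: Q_def)
  ultimately show thesis by (rule that)
qed

lemma sum_Min_le_of_sparse:
  fixes f :: "'a \<Rightarrow> nat"
  assumes "simple_graph V G" and sparse: "\<And>W. W \<subseteq> V \<Longrightarrow> card (edges_in G W) \<le> k * card W"
  shows "(\<Sum>e\<in>G. Min (f ` e)) \<le> k * (\<Sum>v\<in>V. f v)"
proof -
  have V: "finite V" and G: "\<And>e. e \<in> G \<Longrightarrow> e \<subseteq> V \<and> card e = 2"
    using assms by (auto simp: simple_graph_def)
  have finG: "finite G" using G V by (intro finite_subset[of G "Pow V"]) auto
  define M where "M = (\<Sum>v\<in>V. f v)"
  have fM: "f v \<le> M" if "v \<in> V" for v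
    unfolding M_def using that V by (intro member_le_sum) auto
  have layers: "x = card {t \<in> {1..M}. t \<le> x}" if "x \<le> M" for x
  proof -
    have "{t \<in> {1..M}. t \<le> x} = {1..x}" using that by auto
    then show ?thesis by simp
  qed
  have e: "finite e" "e \<noteq> {}" if "e \<in> G" for e
    using G[OF that] by (auto intro: card_ge_0_finite)
  have "(\<Sum>e\<in>G. Min (f ` e)) = (\<Sum>e\<in>G. card {t \<in> {1..M}. t \<le> Min (f ` e)})"
  proof (intro sum.cong layers refl)
    fix e assume "e \<in> G"
    then obtain v where "v \<in> e" "v \<in> V" using e(2) G by blast
    then show "Min (f ` e) \<le> M"
      using fM[of v] e(1)[OF \<open>e \<in> G\<close>] by (meson Min_le finite_imageI image_eqI order_trans)
  qed
  also have "\<dots> = (\<Sum>t\<in>{1..M}. card {e \<in> G. t \<le> Min (f ` e)})"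
    using finG by (intro sum_multicount_gen) auto
  also have "\<dots> \<le> (\<Sum>t\<in>{1..M}. k * card {v \<in> V. t \<le> f v})"
  proof (rule sum_mono)
    fix t
    have "{e \<in> G. t \<le> Min (f ` e)} = edges_in G {v \<in> V. t \<le> f v}"
      using e G by (auto simp: edges_in_def)
    then show "card {e \<in> G. t \<le> Min (f ` e)} \<le> k * card {v \<in> V. t \<le> f v}"
      using sparse by auto
  qed
  also have "\<dots> = k * (\<Sum>v\<in>V. card {t \<in> {1..M}. t \<le> f v})"
    unfolding sum_distrib_left[symmetric]
    using V by (intro arg_cong[where f = "(*) k"] sum_multicount_gen[symmetric]) auto
  also have "(\<Sum>v\<in>V. card {t \<in> {1..M}. t \<le> f v}) = (\<Sum>v\<in>V. f v)"
    by (intro sum.cong layers[symmetric] refl fM)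
  finally show ?thesis .
qed

section \<open>Drawings of subgraphs in the plane\<close>

definition draw :: "('a \<Rightarrow> complex) \<Rightarrow> ('a set \<Rightarrow> real \<Rightarrow> complex) \<Rightarrow> 'a set \<Rightarrow> 'a set set \<Rightarrow> complex set"
  where "draw p \<gamma> U F = p ` U \<union> (\<Union>e\<in>F. path_image (\<gamma> e))"

locale plane_drawing =
  fixes V :: "'a set" and G :: "'a set set" and p :: "'a \<Rightarrow> complex"
    and \<gamma> :: "'a set \<Rightarrow> real \<Rightarrow> complex"
  assumes inj: "inj_on p V"
    and edge_subset: "e \<in> G \<Longrightarrow> e \<subseteq> V"
    and arc: "e \<in> G \<Longrightarrow> arc (\<gamma> e)"
    and ends: "e \<in> G \<Longrightarrow> {pathstart (\<gamma> e), pathfinish (\<gamma> e)} = p ` e"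
    and avoids: "e \<in> G \<Longrightarrow> path_image (\<gamma> e) \<inter> p ` V = p ` e"
    and cross: "e \<in> G \<Longrightarrow> f \<in> G \<Longrightarrow> e \<noteq> f \<Longrightarrow> path_image (\<gamma> e) \<inter> path_image (\<gamma> f) \<subseteq> p ` V"
begin

lemma ends_subset: "e \<in> G \<Longrightarrow> p ` e \<subseteq> path_image (\<gamma> e)"
  using avoids by blast

lemma draw_Int_vertices:
  assumes "U \<subseteq> V" "F \<subseteq> G" "\<Union>F \<subseteq> U"
  shows "draw p \<gamma> U F \<inter> p ` V = p ` U"
proof
  show "draw p \<gamma> U F \<inter> p ` V \<subseteq> p ` U"
    using assms avoids unfolding draw_def by blast
qed (use assms in \<open>auto simp: draw_def\<close>)

text \<open>A common point that is not a vertex would lie on two distinct edges, which meet in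
  vertices only.\<close>

lemma draw_Int_draw:
  assumes U: "U \<subseteq> V" "F \<subseteq> G" "\<Union>F \<subseteq> U" and U': "U' \<subseteq> V" "F' \<subseteq> G" "\<Union>F' \<subseteq> U'"
    and "F \<inter> F' = {}"
  shows "draw p \<gamma> U F \<inter> draw p \<gamma> U' F' \<subseteq> p ` (U \<inter> U')"
proof
  fix x assume x: "x \<in> draw p \<gamma> U F \<inter> draw p \<gamma> U' F'"
  have "x \<in> p ` V"
  proof (rule ccontr)
    assume n: "x \<notin> p ` V"
    then obtain e e' where "e \<in> F" "x \<in> path_image (\<gamma> e)" "e' \<in> F'" "x \<in> path_image (\<gamma> e')"
      using x U U' by (auto simp: draw_def)
    moreover from this have "e \<noteq> e'" using assms by blast
    ultimately show False using cross[of e e'] U U' n by blast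
  qed
  then have "x \<in> p ` U \<inter> p ` U'"
    using x draw_Int_vertices[OF U] draw_Int_vertices[OF U'] by blast
  then show "x \<in> p ` (U \<inter> U')"
    using inj_on_image_Int[OF inj U(1) U'(1)] by simp
qed

lemma path_connected_draw_insert:
  assumes "path_connected (draw p \<gamma> U F)" "u \<in> U" "{u, w} \<in> G"
  shows "path_connected (draw p \<gamma> (insert w U) (insert {u, w} F))"
proof -
  have "draw p \<gamma> (insert w U) (insert {u, w} F) = draw p \<gamma> U F \<union> path_image (\<gamma> {u, w})"
    using ends_subset[OF assms(3)] by (auto simp: draw_def)
  moreover have "p u \<in> draw p \<gamma> U F \<inter> path_image (\<gamma> {u, w})"
    using ends_subset[OF assms(3)] assms(2) by (auto simp: draw_def)
  ultimately show ?thesis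
    using path_connected_Un[OF assms(1) path_connected_path_image[OF arc_imp_path[OF arc[OF assms(3)]]]]
    by auto
qed

lemma connected_in_imp_path_connected_draw:
  assumes "connected_in G U"
  shows "\<exists>F. F \<subseteq> edges_in G U \<and> path_connected (draw p \<gamma> U F)"
  using assms
proof induction
  case (singleton v)
  have "path_connected (draw p \<gamma> {v} {})" by (simp add: draw_def)
  then show ?case by blast
next
  case (insert U u w)
  then obtain F where "F \<subseteq> edges_in G U" "path_connected (draw p \<gamma> U F)" by blast
  then show ?case
    using path_connected_draw_insert[of U F u w] insert
    by (intro exI[of _ "insert {u, w} F"]) (auto simp: edges_in_def)
qed

text \<open>The three branch sets yield three arcs from \<open>a\<close> to \<open>b\<close> and a tripod at \<open>c\<close> with a foot on each.\<close>

lemma no_K33_minor: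
  assumes minor: "K33_minor G a b c U" and sub: "{a, b, c} \<subseteq> V" "\<And>i. i < 3 \<Longrightarrow> U i \<subseteq> V"
    and G: "{} \<notin> G"
  shows False
proof -
  have abc: "a \<noteq> b" "a \<noteq> c" "b \<noteq> c"
    and U: "\<And>i. i < 3 \<Longrightarrow> connected_in G (U i)" "\<And>i. i < 3 \<Longrightarrow> U i \<inter> {a, b, c} = {}"
      "\<And>i v. i < 3 \<Longrightarrow> v \<in> {a, b, c} \<Longrightarrow> \<exists>u\<in>U i. {u, v} \<in> G"
    and disj: "\<And>i j. i < 3 \<Longrightarrow> j < 3 \<Longrightarrow> i \<noteq> j \<Longrightarrow> U i \<inter> U j = {}"
    using minor unfolding K33_minor_def by blast+
  obtain F where F: "\<And>i. i < 3 \<Longrightarrow> F i \<subseteq> edges_in G (U i)"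
    "\<And>i. i < 3 \<Longrightarrow> path_connected (draw p \<gamma> (U i) (F i))"
    using connected_in_imp_path_connected_draw[OF U(1)] by metis
  obtain n where n: "\<And>i v. i < 3 \<Longrightarrow> v \<in> {a, b, c} \<Longrightarrow> n i v \<in> U i \<and> {n i v, v} \<in> G"
    using U(3) by metis
  \<comment> \<open>The drawing of \<open>B i\<close> will carry an arc from \<open>a\<close> to
    \<open>b\<close>, and that of \<open>C i\<close> is the leg of the tripod at \<open>c\<close>
    towards it; both contain the drawing of the branch set \<open>U i\<close>.\<close>
  define B where "B i = insert b (insert a (U i))" for i
  define FB where "FB i = insert {n i b, b} (insert {n i a, a} (F i))" for i
  define C where "C i = insert c (U i)" for i
  define FC where "FC i = insert {n i c, c} (F i)" for i
  have pcB: "path_connected (draw p \<gamma> (B i) (FB i))"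
    and pcC: "path_connected (draw p \<gamma> (C i) (FC i))" if "i < 3" for i
    unfolding B_def FB_def C_def FC_def using F(2) n that
    by (intro path_connected_draw_insert; simp)+
  have B: "B i \<subseteq> V" "FB i \<subseteq> G" "\<Union>(FB i) \<subseteq> B i" and C: "C i \<subseteq> V" "FC i \<subseteq> G" "\<Union>(FC i) \<subseteq> C i"
    if "i < 3" for i
    using sub(1) sub(2)[OF that] F(1)[OF that] n[OF that]
    unfolding B_def FB_def C_def FC_def edges_in_def by blast+
  \<comment> \<open>Every edge of index \<open>i\<close> has an end in \<open>U i\<close>, which
    \<open>B j\<close> avoids for other \<open>j\<close>; hence drawings with different indices
    share no edge.\<close>
  have meets: "e \<inter> U i \<noteq> {}" if i: "i < 3" and e: "e \<in> FB i \<union> FC i" for e i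
  proof (cases "e \<in> F i")
    case True
    then have "e \<subseteq> U i" "e \<noteq> {}" using F(1)[OF i] G by (auto simp: edges_in_def)
    then show ?thesis by blast
  next
    case False
    then obtain v where "v \<in> {a, b, c}" "e = {n i v, v}"
      using e unfolding FB_def FC_def by blast
    then show ?thesis using n[OF i] by blast
  qed
  have BB: "draw p \<gamma> (B i) (FB i) \<inter> draw p \<gamma> (B j) (FB j) \<subseteq> {p a, p b}"
    if ij: "i < 3" "j < 3" "i \<noteq> j" for i j
  proof -
    have "U i \<inter> B j = {}" using disj[OF ij] U(2)[OF ij(1)] by (auto simp: B_def)
    then have "FB i \<inter> FB j = {}"
      using meets[OF ij(1)] B(3)[OF ij(2)] by blast
    then show ?thesis
      using draw_Int_draw[OF B[OF ij(1)] B[OF ij(2)]] disj[OF ij] by (auto simp: B_def)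
  qed
  have CB: "draw p \<gamma> (C i) (FC i) \<inter> draw p \<gamma> (B j) (FB j) = {}"
    if ij: "i < 3" "j < 3" "i \<noteq> j" for i j
  proof -
    have "U i \<inter> B j = {}" using disj[OF ij] U(2)[OF ij(1)] by (auto simp: B_def)
    then have "FC i \<inter> FB j = {}"
      using meets[OF ij(1)] B(3)[OF ij(2)] by blast
    moreover have "C i \<inter> B j = {}"
      using disj[OF ij] U(2)[OF ij(1)] U(2)[OF ij(2)] abc by (auto simp: B_def C_def)
    ultimately show ?thesis
      using draw_Int_draw[OF C[OF ij(1)] B[OF ij(2)]] by auto
  qed
  have "\<exists>g. arc g \<and> path_image g \<subseteq> draw p \<gamma> (B i) (FB i) \<and> pathstart g = p a \<and> pathfinish g = p b"
    if "i < 3" for i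
  proof -
    have "p a \<noteq> p b" using inj abc sub(1) by (auto simp: inj_on_def)
    moreover have "p a \<in> draw p \<gamma> (B i) (FB i)" "p b \<in> draw p \<gamma> (B i) (FB i)"
      by (auto simp: draw_def B_def)
    ultimately show ?thesis
      using pcB[OF that] unfolding path_connected_arcwise by blast
  qed
  then obtain g where g: "\<And>i. i < 3 \<Longrightarrow> arc (g i)" "\<And>i. i < 3 \<Longrightarrow> path_image (g i) \<subseteq> draw p \<gamma> (B i) (FB i)"
    "\<And>i. i < 3 \<Longrightarrow> pathstart (g i) = p a" "\<And>i. i < 3 \<Longrightarrow> pathfinish (g i) = p b"
    by metis
  have g_ends: "p a \<in> path_image (g i)" "p b \<in> path_image (g i)" if "i < 3" for i
    using g(3,4)[OF that] pathstart_in_path_image pathfinish_in_path_image by metis+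
  have gg: "path_image (g i) \<inter> path_image (g j) = {p a, p b}" if "i < 3" "j < 3" "i \<noteq> j" for i j
    using BB[OF that] g(2)[OF that(1)] g(2)[OF that(2)] g_ends[OF that(1)] g_ends[OF that(2)] by blast
  have theta: "theta_curve (p a) (p b) (g 0) (g 1) (g 2)"
    using g gg unfolding theta_curve_def by auto
  have pC: "p a \<notin> draw p \<gamma> (C i) (FC i)" "p b \<notin> draw p \<gamma> (C i) (FC i)" if "i < 3" for i
  proof -
    have "a \<notin> C i" "b \<notin> C i" using U(2)[OF that] abc by (auto simp: C_def)
    then have "p a \<notin> p ` C i" "p b \<notin> p ` C i"
      using inj sub(1) C(1)[OF that] by (auto simp: inj_on_image_mem_iff)
    then show "p a \<notin> draw p \<gamma> (C i) (FC i)" "p b \<notin> draw p \<gamma> (C i) (FC i)"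
      using draw_Int_vertices[OF C[OF that]] sub(1) by auto
  qed
  \<comment> \<open>An arc missing the leg would be covered by the two edges that attach
    \<open>a\<close> and \<open>b\<close> to \<open>U i\<close>. These closed sets meet at most in a
    drawn vertex of \<open>U i\<close>, hence not on the arc, and so would disconnect it.\<close>
  have foot: "draw p \<gamma> (C i) (FC i) \<inter> path_image (g i) \<noteq> {}" if i: "i < 3" for i
  proof
    assume "draw p \<gamma> (C i) (FC i) \<inter> path_image (g i) = {}"
    then have X: "draw p \<gamma> (U i) (F i) \<inter> path_image (g i) = {}"
      by (auto simp: draw_def C_def FC_def)
    let ?a = "path_image (\<gamma> {n i a, a})" and ?b = "path_image (\<gamma> {n i b, b})"
    have e: "{n i a, a} \<in> G" "{n i b, b} \<in> G" "n i a \<in> U i" "n i b \<in> U i" using n[OF i] by auto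
    have "draw p \<gamma> (B i) (FB i) \<subseteq> draw p \<gamma> (U i) (F i) \<union> ?a \<union> ?b"
      using ends_subset[OF e(1)] ends_subset[OF e(2)] by (auto simp: draw_def B_def FB_def)
    then have cover: "path_image (g i) \<subseteq> ?a \<union> ?b"
      using g(2)[OF i] X by blast
    have ne: "{n i a, a} \<noteq> {n i b, b}"
      using e U(2)[OF i] abc by (auto simp: doubleton_eq_iff)
    have "?a \<inter> ?b \<subseteq> p ` {n i a, a} \<inter> p ` {n i b, b}"
      using cross[OF e(1,2) ne] avoids[OF e(1)] avoids[OF e(2)] by blast
    also have "\<dots> = p ` ({n i a, a} \<inter> {n i b, b})"
      using inj_on_image_Int[OF inj edge_subset[OF e(1)] edge_subset[OF e(2)]] by simp
    also have "\<dots> \<subseteq> p ` U i"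
      using e abc by auto
    finally have "?a \<inter> ?b \<inter> path_image (g i) = {}"
      using X by (auto simp: draw_def)
    moreover have "closed ?a" "closed ?b"
      using arc e by (auto intro: closed_arc_image)
    moreover have "?a \<inter> path_image (g i) \<noteq> {}" "?b \<inter> path_image (g i) \<noteq> {}"
      using g_ends[OF i] ends_subset[OF e(1)] ends_subset[OF e(2)] by auto
    moreover have "connected (path_image (g i))"
      using g(1)[OF i] by (rule connected_arc_image)
    ultimately show False
      using cover unfolding connected_closed by blast
  qed
  have "p c \<in> draw p \<gamma> (C i) (FC i)" for i by (auto simp: draw_def C_def)
  moreover have "p c \<notin> path_image (g i)" if "i < 3" for i
  proof -
    have "c \<notin> B i" using U(2)[OF that] abc by (auto simp: B_def)
    then have "p c \<notin> p ` B i"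
      using inj sub(1) B(1)[OF that] by (auto simp: inj_on_image_mem_iff)
    then show ?thesis
      using draw_Int_vertices[OF B[OF that]] sub(1) g(2)[OF that] by auto
  qed
  moreover have "\<exists>T. connected T \<and> p c \<in> T \<and> T \<inter> path_image (g i) \<noteq> {} \<and>
      T \<inter> (path_image (g 0) \<union> path_image (g 1) \<union> path_image (g 2)) \<subseteq> path_image (g i) - {p a, p b}"
    if i: "i < 3" for i
  proof (intro exI[of _ "draw p \<gamma> (C i) (FC i)"] conjI foot i)
    show "connected (draw p \<gamma> (C i) (FC i))"
      using pcC[OF i] by (rule path_connected_imp_connected)
    have "draw p \<gamma> (C i) (FC i) \<inter> path_image (g j) \<subseteq> path_image (g i)" if "j < 3" for j
      using CB[OF i that] g(2)[OF that] by (cases "i = j") auto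
    then have "draw p \<gamma> (C i) (FC i) \<inter> (path_image (g 0) \<union> path_image (g 1) \<union> path_image (g 2))
        \<subseteq> path_image (g i)"
      unfolding Int_Un_distrib by simp
    then show "draw p \<gamma> (C i) (FC i) \<inter> (path_image (g 0) \<union> path_image (g 1) \<union> path_image (g 2))
        \<subseteq> path_image (g i) - {p a, p b}"
      using pC[OF i] by blast
  qed (auto simp: draw_def C_def)
  ultimately show False
    by (intro theta_curve_no_tripod[OF theta, of "p c"]) auto
qed

end

theorem planar_sparse:
  assumes "simple_graph V G" "planar V G" "W \<subseteq> V"
  shows "card (edges_in G W) \<le> 8 * card W"
\<comment> \<open>The empty set meets the density condition
  \<open>8 * card W <= card (edges_in G W)\<close> trivially, so it cannot be handled by finding a
  minor.\<close>
proof (cases "W = {}")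
  case True
  then have "edges_in G W = {}"
    using assms(1) by (fastforce simp: edges_in_def simple_graph_def)
  then show ?thesis by simp
next
  case False
  have G: "\<forall>e\<in>G. card e = 2" and "finite W"
    using assms finite_subset by (auto simp: simple_graph_def)
  obtain p :: "'a \<Rightarrow> complex" and \<gamma> where
    p: "inj_on p V" and "\<forall>e\<in>G. arc (\<gamma> e) \<and> {pathstart (\<gamma> e), pathfinish (\<gamma> e)} = p ` e \<and>
      path_image (\<gamma> e) \<inter> p ` V = p ` e"
    and "\<forall>e\<in>G. \<forall>f\<in>G. e \<noteq> f \<longrightarrow> path_image (\<gamma> e) \<inter> path_image (\<gamma> f) \<subseteq> p ` V"
    using assms(2) unfolding planar_def by blast
  then have drawing: "plane_drawing V G p \<gamma>"
    using assms(1) by unfold_locales (simp_all add: simple_graph_def)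
  have "{} \<notin> G" using G by force
  show ?thesis
  proof (rule ccontr)
    assume "\<not> ?thesis"
    then have "8 * card W \<le> card (edges_in G W)" by simp
    then obtain a b c U where "K33_minor G a b c U" "{a, b, c} \<subseteq> W" "\<And>i. i < 3 \<Longrightarrow> U i \<subseteq> W"
      using dense_imp_K33_minor[OF G \<open>finite W\<close> False] by metis
    then show False
      using plane_drawing.no_K33_minor[OF drawing _ _ _ \<open>{} \<notin> G\<close>, of a b c U] assms(3) by blast
  qed
qed


section \<open>Running time of the triejoin\<close>

lemma filter_dropWhile_less:
  fixes x :: "'a::linorder"
  assumes "sorted_wrt (<) xs" "\<And>z. P z \<Longrightarrow> x \<le> z"
  shows "filter P (dropWhile (\<lambda>y. y < x) xs) = filter P xs"
  using assms by (induction xs) (auto simp: not_less[symmetric])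

lemma set_dropWhile_less:
  fixes x :: "'a::linorder"
  assumes "x \<le> z"
  shows "z \<in> set (dropWhile (\<lambda>y. y < x) xs) \<longleftrightarrow> z \<in> set xs"
  using assms by (induction xs) auto

lemma strict_sorted_dropWhile:
  "sorted_wrt (<) xs \<Longrightarrow> sorted_wrt (<) (dropWhile Q xs)"
  by (induction xs) auto

text \<open>A seek skips only values below the current key of the other list; that list is sorted,
  so no skipped value is common to both.\<close>

lemma leapfrog_output:
  fixes xs ys :: "'a::linorder list"
  assumes "sorted_wrt (<) xs" "sorted_wrt (<) ys"
  shows "fst (leapfrog xs ys) = filter (\<lambda>x. x \<in> set ys) xs"
  using assms
proof (induction xs ys rule: leapfrog.induct)
  case (3 x xs y ys)
  consider "x = y" | "x \<noteq> y" "x < y" | "x \<noteq> y" "\<not> x < y" "y < x" by fastforce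
  then show ?case
  proof cases
    case 1
    then show ?thesis using 3 by (auto simp: split_beta)
  next
    case 2
    then have "fst (leapfrog (move (Seek y) (x # xs)) (y # ys))
        = filter (\<lambda>z. z \<in> set (y # ys)) (dropWhile (\<lambda>x. x < y) (x # xs))"
      using 3 strict_sorted_dropWhile[of "x # xs"] by (simp add: dual_order.strict_implies_not_eq)
    also have "\<dots> = filter (\<lambda>z. z \<in> set (y # ys)) (x # xs)"
      using 3(4,5) by (intro filter_dropWhile_less) auto
    finally show ?thesis using 2 by (simp add: split_beta del: move.simps)
  next
    case b: 3
    then have "fst (leapfrog (x # xs) (move (Seek x) (y # ys)))
        = filter (\<lambda>z. z \<in> set (dropWhile (\<lambda>y. y < x) (y # ys))) (x # xs)"
      using 3 strict_sorted_dropWhile[of "y # ys"] by simp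
    also have "\<dots> = filter (\<lambda>z. z \<in> set (y # ys)) (x # xs)"
      using 3(4) by (intro filter_cong refl set_dropWhile_less) auto
    finally show ?thesis using b by (simp add: split_beta del: move.simps)
  qed
qed auto

text \<open>Only the iterator with the strictly smaller key seeks, so every move leaves its key.
  This brings the recorded operations under the assumed time bounds.\<close>

lemma leapfrog_advancing:
  assumes "leapfrog xs ys = (out, ps, qs, n)"
  shows "advancing xs ps \<and> advancing ys qs"
  using assms
proof (induction xs ys arbitrary: out ps qs n rule: leapfrog.induct)
  case (2 x xs)
  then show ?case by (cases "x # xs") auto
next
  case (3 x xs y ys)
  then show ?case by (auto split: if_splits prod.splits simp del: move.simps)
qed auto

lemma length_move_less:
  assumes "advancing (x # xs) (p # ps)"
  shows "length (move p (x # xs)) \<le> length xs"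
  using assms by (cases p) (auto simp: length_dropWhile_le)

lemma length_advancing_le: "advancing xs ps \<Longrightarrow> length ps \<le> length xs"
proof (induction xs ps rule: advancing.induct)
  case (3 x xs p ps)
  then show ?case using length_move_less[of x xs p ps] by (auto simp del: move.simps)
qed auto

lemma advancing_take: "advancing xs ps \<Longrightarrow> advancing xs (take i ps)"
proof (induction xs ps arbitrary: i rule: advancing.induct)
  case (3 x xs p ps)
  then show ?case by (cases i) auto
qed auto

text \<open>If \<open>x < y\<close>, the first iterator may seek to \<open>y\<close> and, after a
  match, step past it, which makes two moves; at a match only the step is left.\<close>

fun lead :: "'a::linorder list \<Rightarrow> 'a list \<Rightarrow> nat" where
  "lead (x # xs) (y # ys) = (if x < y then 2 else if x = y then 1 else 0)"
| "lead _ _ = 0"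

lemma lead_le_2: "lead xs ys \<le> 2"
  by (induction xs ys rule: lead.induct) auto

lemma lead_seek_first: "lead (dropWhile (\<lambda>x. x < y) xs) (y # ys) \<le> 1"
  by (induction xs) auto

lemma lead_seek_second: "dropWhile (\<lambda>y. y < x) ys \<noteq> [] \<Longrightarrow> lead (x # xs) (dropWhile (\<lambda>y. y < x) ys) \<noteq> 0"
  by (induction ys) auto

text \<open>The second iterator never moves twice in a row, and the first one at most twice. The value
  \<open>lead\<close> is the number of moves that the first iterator may still make before the second one.\<close>

lemma leapfrog_moves:
  assumes "leapfrog xs ys = (out, ps, qs, n)" "sorted_wrt (<) xs" "sorted_wrt (<) ys"
  shows "length ps \<le> 2 * length qs + lead xs ys"
    and "length qs \<le> length ps + (if lead xs ys = 0 then 1 else 0)"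
    and "n \<le> 5 * (length ps + length qs) + 2"
proof -
  have "length ps \<le> 2 * length qs + lead xs ys \<and>
      length qs \<le> length ps + (if lead xs ys = 0 then 1 else 0) \<and>
      n \<le> 5 * (length ps + length qs) + 2"
    using assms
  proof (induction xs ys arbitrary: out ps qs n rule: leapfrog.induct)
    case (3 x xs y ys)
    consider "x = y" | "x \<noteq> y" "x < y" | "x \<noteq> y" "\<not> x < y" "y < x" by fastforce
    then show ?case
    proof cases
      case 1
      obtain out' ps' qs' n' where l: "leapfrog (move Next (x # xs)) (y # ys) = (out', ps', qs', n')"
        by (metis prod_cases4)
      \<comment> \<open>After a match the next key of the first iterator exceeds \<open>y\<close>,
        so it is the second one's turn.\<close>
      have "lead xs (y # ys) = 0"
        using 1 "3.prems"(2) by (cases xs) auto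
      then show ?thesis
        using "3.IH"(1)[OF 1 l] "3.prems" 1 l by auto
    next
      case 2
      obtain out' ps' qs' n' where l: "leapfrog (move (Seek y) (x # xs)) (y # ys) = (out', ps', qs', n')"
        by (metis prod_cases4)
      have eq: "ps = Seek y # ps'" "qs = qs'" "n = 5 + n'"
        using 2 "3.prems"(1) l by (auto simp del: move.simps)
      have "length ps' \<le> 2 * length qs' + lead (move (Seek y) (x # xs)) (y # ys)"
        "length qs' \<le> length ps' + 1" "n' \<le> 5 * (length ps' + length qs') + 2"
        using "3.IH"(2)[OF 2 l] "3.prems"(2,3) 2 strict_sorted_dropWhile[of "x # xs"]
        by (auto simp del: lead.simps split: if_splits)
      then show ?thesis
        using 2 lead_seek_first[of y "x # xs" ys] eq by simp
    next
      case b: 3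
      obtain out' ps' qs' n' where l: "leapfrog (x # xs) (move (Seek x) (y # ys)) = (out', ps', qs', n')"
        by (metis prod_cases4)
      have eq: "ps = ps'" "qs = Seek x # qs'" "n = 5 + n'"
        using b "3.prems"(1) l by (auto simp del: move.simps)
      have IH: "length ps' \<le> 2 * length qs' + lead (x # xs) (move (Seek x) (y # ys))"
        "length qs' \<le> length ps' + (if lead (x # xs) (move (Seek x) (y # ys)) = 0 then 1 else 0)"
        "n' \<le> 5 * (length ps' + length qs') + 2"
        using "3.IH"(3)[OF b(1,2) l] "3.prems"(2,3) b strict_sorted_dropWhile[of "y # ys"] by auto
      \<comment> \<open>The second iterator lands at or beyond \<open>x\<close>, so the first one
        moves next, unless the end is reached and no moves remain.\<close>
      have "length qs' \<le> length ps'"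
      proof (cases "move (Seek x) (y # ys) = []")
        case True
        then show ?thesis using l by simp
      next
        case False
        then show ?thesis using IH(2) lead_seek_second[of x "y # ys" xs] by simp
      qed
      then show ?thesis
        using b IH(1,3) lead_le_2[of "x # xs" "move (Seek x) (y # ys)"] eq by simp
    qed
  qed auto
  then show "length ps \<le> 2 * length qs + lead xs ys"
    and "length qs \<le> length ps + (if lead xs ys = 0 then 1 else 0)"
    and "n \<le> 5 * (length ps + length qs) + 2"
    by auto
qed

section \<open>Cost of a join in terms of the smaller set\<close>

definition seek_time_le :: "real \<Rightarrow> 'a::linorder move_time \<Rightarrow> bool" where
  "seek_time_le c mt \<longleftrightarrow> c \<ge> 0 \<and> (\<forall>S ps. finite S \<and> ps \<noteq> [] \<and> advancing (sorted_list_of_set S) ps \<longrightarrow>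
     real (mt S ps) \<le> c * (1 + log 2 (card S)))"

lemma efficient_imp_seek_time_le:
  assumes "efficient_iterators mt"
  obtains c where "seek_time_le c mt"
proof -
  obtain c where c: "\<And>S ps. finite S \<Longrightarrow> ps \<noteq> [] \<Longrightarrow> advancing (sorted_list_of_set S) ps \<Longrightarrow>
      real (mt S ps) \<le> c * (1 + log 2 (card S))"
    using assms unfolding efficient_iterators_def Let_def by metis
  \<comment> \<open>\<open>max c 0\<close> supplies the nonnegativity that all later monotonicity
    steps rely on.\<close>
  have "real (mt S ps) \<le> max c 0 * (1 + log 2 (card S))"
    if p: "finite S" "ps \<noteq> []" "advancing (sorted_list_of_set S) ps" for S ps
  proof -
    have "card S \<ge> 1"
      using length_advancing_le[OF p(3)] p(1,2) by (cases ps) auto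
    then have "c * (1 + log 2 (card S)) \<le> max c 0 * (1 + log 2 (card S))"
      by (intro mult_right_mono) (auto simp: add_nonneg_nonneg)
    then show ?thesis using c[OF p] by linarith
  qed
  then have "seek_time_le (max c 0) mt" unfolding seek_time_le_def by simp
  then show thesis by (rule that)
qed

text \<open>The common size bound \<open>m\<close> lets all joins of the triejoin be charged at one
  rate; it will be the number of edges.\<close>

lemma run_time_le:
  assumes c: "seek_time_le c mt" and S: "finite S" "card S \<le> m"
    and ps: "advancing (sorted_list_of_set S) ps"
  shows "real (run_time mt S ps) \<le> length ps * (c * (1 + log 2 m))"
proof -
  have "real (run_time mt S ps) \<le> (\<Sum>i = 1..length ps. c * (1 + log 2 m))"
    unfolding run_time_def of_nat_sum
  proof (rule sum_mono)
    fix i assume i: "i \<in> {1..length ps}"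
    then have "take i ps \<noteq> []" by auto
    then have le: "real (mt S (take i ps)) \<le> c * (1 + log 2 (card S))"
      using c S advancing_take[OF ps] unfolding seek_time_le_def by blast
    have "card S \<ge> 1"
      using length_advancing_le[OF ps] i S(1) by auto
    then have "log 2 (card S) \<le> log 2 m"
      using S(2) by (intro log_mono) auto
    then have "c * (1 + log 2 (card S)) \<le> c * (1 + log 2 m)"
      using c by (intro mult_left_mono) (auto simp: seek_time_le_def)
    then show "real (mt S (take i ps)) \<le> c * (1 + log 2 m)"
      using le by linarith
  qed
  then show ?thesis by simp
qed

lemma leapfrog_join_keys:
  assumes "finite S" "finite T"
  shows "fst (leapfrog_join mt S T) = sorted_list_of_set (S \<inter> T)"
proof -
  let ?xs = "filter (\<lambda>x. x \<in> T) (sorted_list_of_set S)"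
  have "fst (leapfrog_join mt S T) = ?xs"
    using leapfrog_output[of "sorted_list_of_set S" "sorted_list_of_set T"] assms
    by (simp add: leapfrog_join_def split_beta)
  moreover have "sorted_wrt (<) ?xs"
    by (intro sorted_wrt_filter) simp
  moreover have "set ?xs = S \<inter> T" using assms by auto
  ultimately show ?thesis
    using assms by (metis finite_Int sorted_list_of_set.strict_sorted_key_list_of_set
      sorted_list_of_set.set_sorted_key_list_of_set strict_sorted_equal)
qed

text \<open>If \<open>S\<close> is the smaller set, there are at most \<open>N\<close> and
  \<open>N + 1\<close> moves; if \<open>T\<close> is, at most \<open>2 * N + 2\<close> and
  \<open>N\<close>. Either way 6 \<open>N\<close> moves suffice, with at most 30 \<open>N\<close> +
  2 unit steps; the two opening steps make this at most 34 \<open>N\<close>.\<close>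

lemma leapfrog_join_time:
  assumes c: "seek_time_le c mt" and fin: "finite S" "finite T" and ne: "S \<noteq> {}" "T \<noteq> {}"
    and m: "card S \<le> m" "card T \<le> m"
  shows "real (snd (leapfrog_join mt S T)) \<le>
    (34 + 6 * c) * min (card S) (card T) * (1 + log 2 m)"
proof -
  obtain out ps qs n where l: "leapfrog (sorted_list_of_set S) (sorted_list_of_set T) = (out, ps, qs, n)"
    by (metis prod_cases4)
  define N where "N = min (card S) (card T)"
  define L where "L = 1 + log 2 m"
  have N: "N \<ge> 1" using fin ne by (simp add: N_def Suc_le_eq card_gt_0_iff)
  have adv: "advancing (sorted_list_of_set S) ps" "advancing (sorted_list_of_set T) qs"
    using leapfrog_advancing[OF l] by auto
  have "length ps \<le> card S" "length qs \<le> card T"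
    using adv[THEN length_advancing_le] by auto
  moreover have "length ps \<le> 2 * length qs + 2" "length qs \<le> length ps + 1"
    and n: "n \<le> 5 * (length ps + length qs) + 2"
    using leapfrog_moves[OF l] lead_le_2[of "sorted_list_of_set S" "sorted_list_of_set T"]
    by (auto split: if_splits)
  ultimately have len: "length ps \<le> 4 * N" "length qs \<le> 2 * N"
    using N unfolding N_def by auto
  have c0: "c \<ge> 0" using c by (simp add: seek_time_le_def)
  have "m \<ge> 1" using N m unfolding N_def by simp
  then have L: "L \<ge> 1" by (simp add: L_def)
  have r: "real (run_time mt S ps) \<le> length ps * (c * L)" "real (run_time mt T qs) \<le> length qs * (c * L)"
    unfolding L_def using adv fin m by (auto intro!: run_time_le[OF c])
  have "length ps * (c * L) + length qs * (c * L) = real (length ps + length qs) * (c * L)"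
    by (simp add: algebra_simps)
  also have "\<dots> \<le> real (6 * N) * (c * L)"
    using len c0 L by (intro mult_right_mono) (simp_all del: of_nat_add of_nat_mult)
  finally have run: "real (run_time mt S ps) + real (run_time mt T qs) \<le> 6 * c * N * L"
    using r by (simp add: algebra_simps)
  have "2 + n \<le> 34 * N"
    using n len N by simp
  then have "real (2 + n) \<le> real (34 * N)"
    by (rule of_nat_mono)
  also have "\<dots> \<le> 34 * N * L"
    using L by (simp add: mult_le_cancel_left1)
  finally have "real (2 + n) \<le> 34 * N * L" .
  moreover have "snd (leapfrog_join mt S T) = 2 + n + run_time mt S ps + run_time mt T qs"
    using l by (simp add: leapfrog_join_def)
  ultimately show ?thesis
    using run unfolding N_def[symmetric] L_def[symmetric] by (simp add: algebra_simps)
qed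

section \<open>The nested loops of the triejoin\<close>

lemma for_join_output:
  assumes "finite S" "finite T"
  shows "fst (for_join mt S T body) = concat (map (\<lambda>k. fst (body k)) (sorted_list_of_set (S \<inter> T)))"
  using leapfrog_join_keys[OF assms] by (simp add: for_join_def split_beta Let_def comp_def)

lemma for_join_steps:
  assumes "finite S" "finite T"
  shows "snd (for_join mt S T body) = snd (leapfrog_join mt S T) + (\<Sum>k\<in>S \<inter> T. snd (body k))"
  using leapfrog_join_keys[OF assms] assms
  by (simp add: for_join_def split_beta Let_def comp_def sum_list_distinct_conv_sum_set)

lemma set_for_join:
  assumes "finite S" "finite T"
  shows "set (fst (for_join mt S T body)) = (\<Union>k\<in>S \<inter> T. set (fst (body k)))"
  using assms by (simp add: for_join_output)

lemma distinct_concat_map: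
  assumes "distinct ks" "\<And>k. k \<in> set ks \<Longrightarrow> distinct (f k)"
    "\<And>j k. j \<in> set ks \<Longrightarrow> k \<in> set ks \<Longrightarrow> j \<noteq> k \<Longrightarrow> set (f j) \<inter> set (f k) = {}"
  shows "distinct (concat (map f ks))"
  using assms by (induction ks) (auto simp: disjoint_iff; blast)+

lemma distinct_for_join:
  assumes "finite S" "finite T" "\<And>k. k \<in> S \<inter> T \<Longrightarrow> distinct (fst (body k))"
    "\<And>j k. j \<in> S \<inter> T \<Longrightarrow> k \<in> S \<inter> T \<Longrightarrow> j \<noteq> k \<Longrightarrow> set (fst (body j)) \<inter> set (fst (body k)) = {}"
  shows "distinct (fst (for_join mt S T body))"
  unfolding for_join_output[OF assms(1,2)]
  using assms by (intro distinct_concat_map) auto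

lemma lftj_output:
  assumes "finite E"
  shows "set (lftj_output mt E) = {(a, b, c). (a, b) \<in> E \<and> (a, c) \<in> E \<and> (b, c) \<in> E}" (is ?set)
    and "distinct (lftj_output mt E)" (is ?distinct)
proof -
  have fin: "finite (Domain E)" "\<And>v. finite (E `` {v})"
    using assms by (auto simp: finite_Domain finite_Image)
  define loop_c where "loop_c a b = for_join mt (E `` {a}) (E `` {b}) (\<lambda>c. ([(a, b, c)], 1))" for a b
  define loop_b where "loop_b a = for_join mt (Domain E) (E `` {a}) (loop_c a)" for a
  have lftj: "lftj_triangle mt E = for_join mt (Domain E) (Domain E) loop_b"
    unfolding lftj_triangle_def Let_def loop_b_def loop_c_def ..
  have c: "set (fst (loop_c a b)) = {(a, b, c) | c. (a, c) \<in> E \<and> (b, c) \<in> E}"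
    "distinct (fst (loop_c a b))" for a b
    unfolding loop_c_def using fin by (auto simp: set_for_join intro!: distinct_for_join)
  have b: "set (fst (loop_b a)) = {(a, b, c) | b c. (a, b) \<in> E \<and> (a, c) \<in> E \<and> (b, c) \<in> E}"
    "distinct (fst (loop_b a))" for a
    unfolding loop_b_def using fin by (auto simp: set_for_join c intro!: distinct_for_join)
  show ?set ?distinct
    unfolding lftj using fin by (auto simp: set_for_join b intro!: distinct_for_join)
qed

text \<open>The outer join costs at most \<open>|E|\<close> units of
  \<open>1 + log 2 (card E)\<close> up to the constant, since every source has an edge. The middle
  joins cost the out-degrees, which again sum to \<open>|E|\<close>, and the inner joins contribute
  the sum of minima. The constant grows from 34 to 35 for emitting the triangles, at most as many as
  the minimum.\<close>

proposition lftj_steps_le: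
  assumes c: "seek_time_le c mt" and E: "finite E" "E \<noteq> {}"
  shows "real (lftj_steps mt E) \<le> (35 + 6 * c) * (1 + log 2 (card E)) *
    (2 * card E + (\<Sum>(a, b)\<in>E. min (card (E `` {a})) (card (E `` {b}))))"
proof -
  let ?V = "Domain E" and ?D = "\<lambda>v. E `` {v}" and ?K = "34 + 6 * c" and ?L = "1 + log 2 (card E)"
  let ?min = "\<lambda>a b. min (card (?D a)) (card (?D b))"
  have fin: "finite ?V" "\<And>v. finite (?D v)"
    using E by (auto simp: finite_Domain finite_Image)
  have cV: "card ?V \<le> card E"
    using card_image_le[OF E(1), of fst] by (simp add: Domain_fst)
  have cD: "card (?D v) \<le> card E" for v
  proof -
    have "?D v \<subseteq> snd ` E" by force
    then show ?thesis using E(1) by (meson card_image_le card_mono finite_imageI order_trans)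
  qed
  have "?V \<noteq> {}" using E by auto
  have "card E \<ge> 1" using E by (simp add: Suc_le_eq card_gt_0_iff)
  then have L: "?L \<ge> 1" by simp
  have c0: "c \<ge> 0" using c by (simp add: seek_time_le_def)
  define loop_c where "loop_c a b = for_join mt (?D a) (?D b) (\<lambda>c. ([(a, b, c)], 1))" for a b
  define loop_b where "loop_b a = for_join mt ?V (?D a) (loop_c a)" for a
  have lftj: "lftj_triangle mt E = for_join mt ?V ?V loop_b"
    unfolding lftj_triangle_def Let_def loop_b_def loop_c_def ..
  have lc: "real (snd (loop_c a b)) \<le> (35 + 6 * c) * ?L * ?min a b" if "a \<in> ?V" "b \<in> ?V" for a b
  proof -
    \<comment> \<open>The bound for joins requires non-empty sets; the outer loops guarantee this by
      running over sources of edges only.\<close>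
    have "?D a \<noteq> {}" "?D b \<noteq> {}" using that by auto
    then have "real (snd (leapfrog_join mt (?D a) (?D b))) \<le> ?K * ?min a b * ?L"
      by (intro leapfrog_join_time c fin cD)
    moreover have "card (?D a \<inter> ?D b) \<le> ?min a b"
      using fin by (simp add: card_mono)
    then have "real (card (?D a \<inter> ?D b)) \<le> ?min a b * ?L"
      using L by (meson mult_le_cancel_left1 of_nat_0_le_iff of_nat_mono order_trans linorder_not_less)
    ultimately show ?thesis
      unfolding loop_c_def for_join_steps[OF fin(2) fin(2)] by (simp add: algebra_simps)
  qed
  have lb: "real (snd (loop_b a)) \<le> ?K * card (?D a) * ?L + (\<Sum>b\<in>?D a. (35 + 6 * c) * ?L * ?min a b)"
    if a: "a \<in> ?V" for a
  proof -
    have "?D a \<noteq> {}" using a by auto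
    then have "real (snd (leapfrog_join mt ?V (?D a))) \<le> ?K * min (card ?V) (card (?D a)) * ?L"
      by (intro leapfrog_join_time c fin cD cV \<open>?V \<noteq> {}\<close>)
    also have "\<dots> \<le> ?K * card (?D a) * ?L"
      using L c0 by (intro mult_right_mono mult_left_mono) auto
    finally have "real (snd (leapfrog_join mt ?V (?D a))) \<le> ?K * card (?D a) * ?L" .
    moreover have "(\<Sum>b\<in>?V \<inter> ?D a. real (snd (loop_c a b))) \<le> (\<Sum>b\<in>?V \<inter> ?D a. (35 + 6 * c) * ?L * ?min a b)"
      using lc[OF a] by (intro sum_mono) auto
    \<comment> \<open>Adding the \<open>b\<close> without outgoing edges is harmless and turns the
      double sum into a sum over \<open>E\<close>.\<close>
    moreover have "\<dots> \<le> (\<Sum>b\<in>?D a. (35 + 6 * c) * ?L * ?min a b)"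
      using fin L c0 by (intro sum_mono2) auto
    ultimately show ?thesis
      unfolding loop_b_def for_join_steps[OF fin(1) fin(2)] by simp
  qed
  have Sig: "(SIGMA a:?V. ?D a) = E" by auto
  have "card E = (\<Sum>a\<in>?V. card (?D a))"
    using card_SigmaI[of ?V ?D] fin unfolding Sig by simp
  then have sumD: "(\<Sum>a\<in>?V. ?K * card (?D a) * ?L) = ?K * card E * ?L"
    by (simp add: sum_distrib_left sum_distrib_right)
  have "(\<Sum>a\<in>?V. \<Sum>b\<in>?D a. (35 + 6 * c) * ?L * real (?min a b)) = (\<Sum>(a, b)\<in>E. (35 + 6 * c) * ?L * real (?min a b))"
    using sum.Sigma[of ?V ?D "\<lambda>a b. (35 + 6 * c) * ?L * real (?min a b)"] fin unfolding Sig by simp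
  also have "\<dots> = (35 + 6 * c) * ?L * real (\<Sum>(a, b)\<in>E. ?min a b)"
    by (simp add: sum_distrib_left split_beta)
  finally have summin: "(\<Sum>a\<in>?V. \<Sum>b\<in>?D a. (35 + 6 * c) * ?L * real (?min a b))
      = (35 + 6 * c) * ?L * real (\<Sum>(a, b)\<in>E. ?min a b)" .
  have "real (snd (leapfrog_join mt ?V ?V)) \<le> ?K * card ?V * ?L"
    using leapfrog_join_time[OF c fin(1) fin(1) \<open>?V \<noteq> {}\<close> \<open>?V \<noteq> {}\<close> cV cV] by simp
  also have "\<dots> \<le> ?K * card E * ?L"
    using cV L c0 by (intro mult_right_mono mult_left_mono) auto
  finally have la: "real (snd (leapfrog_join mt ?V ?V)) \<le> ?K * card E * ?L" .
  have sum_loop_b: "(\<Sum>a\<in>?V. real (snd (loop_b a)))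
      \<le> ?K * card E * ?L + (35 + 6 * c) * ?L * real (\<Sum>(a, b)\<in>E. ?min a b)"
    unfolding sumD[symmetric] summin[symmetric] sum.distrib[symmetric]
    by (intro sum_mono lb)
  have "real (lftj_steps mt E) = real (snd (leapfrog_join mt ?V ?V)) + (\<Sum>a\<in>?V. real (snd (loop_b a)))"
    unfolding lftj for_join_steps[OF fin(1) fin(1)] by simp
  also have "\<dots> \<le> ?K * card E * ?L + (?K * card E * ?L + (35 + 6 * c) * ?L * real (\<Sum>(a, b)\<in>E. ?min a b))"
    using la sum_loop_b by linarith
  also have "\<dots> \<le> (35 + 6 * c) * ?L * (2 * card E + (\<Sum>(a, b)\<in>E. ?min a b))"
  proof -
    have "0 \<le> card E * ?L" using L by simp
    then show ?thesis by (simp add: algebra_simps)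
  qed
  finally show ?thesis .
qed


section \<open>From oriented edges back to the undirected graph\<close>

lemma card_2_Min_Max:
  fixes e :: "'a::linorder set"
  assumes "card e = 2"
  shows "e = {Min e, Max e}" "Min e < Max e"
proof -
  obtain x y where "x \<noteq> y" "e = {x, y}" using assms by (auto simp: card_2_iff)
  then show "e = {Min e, Max e}" "Min e < Max e" by (auto simp: min_def max_def)
qed

lemma orient_iff:
  assumes "\<forall>e\<in>G. card e = 2"
  shows "(a, b) \<in> orient G \<longleftrightarrow> a < b \<and> {a, b} \<in> G"
proof
  assume "(a, b) \<in> orient G"
  then obtain e where e: "e \<in> G" "a = Min e" "b = Max e" by (auto simp: orient_def)
  then show "a < b \<and> {a, b} \<in> G"
    using card_2_Min_Max[OF bspec[OF assms e(1)]] by metis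
next
  assume *: "a < b \<and> {a, b} \<in> G"
  then have "Min {a, b} = a" "Max {a, b} = b" by auto
  then show "(a, b) \<in> orient G" unfolding orient_def using * by (metis (no_types, lifting) image_eqI)
qed

lemma inj_on_orient:
  assumes "\<forall>e\<in>G. card e = 2"
  shows "inj_on (\<lambda>e. (Min e, Max e)) G"
proof (rule inj_onI)
  fix x y assume "x \<in> G" "y \<in> G" and eq: "(Min x, Max x) = (Min y, Max y)"
  have "x = {Min x, Max x}" by (rule card_2_Min_Max(1)[OF bspec[OF assms \<open>x \<in> G\<close>]])
  moreover have "y = {Min y, Max y}" by (rule card_2_Min_Max(1)[OF bspec[OF assms \<open>y \<in> G\<close>]])
  moreover have "{Min x, Max x} = {Min y, Max y}" using eq by simp
  ultimately show "x = y" by order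
qed

lemma sum_orient:
  assumes "\<forall>e\<in>G. card e = 2"
  shows "(\<Sum>(a, b)\<in>orient G. f a b) = (\<Sum>e\<in>G. f (Min e) (Max e))"
  unfolding orient_def by (simp add: sum.reindex[OF inj_on_orient[OF assms]])

lemma finite_simple_graph: "simple_graph V G \<Longrightarrow> finite G"
  by (rule finite_subset[of _ "Pow V"]) (auto simp: simple_graph_def)

lemma lftj_lists_triangles:
  assumes "simple_graph V G"
  shows "lists_triangles (lftj_output mt (orient G)) G"
proof -
  have G: "\<forall>e\<in>G. card e = 2" using assms by (simp add: simple_graph_def)
  have fin: "finite (orient G)"
    using finite_simple_graph[OF assms] by (simp add: orient_def)
  show ?thesis
    unfolding lists_triangles_def using lftj_output[OF fin] by (auto simp: orient_iff[OF G])
qed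

text \<open>Assumption \<open>k\<close> is the interface to the two graph classes: each enters the
  running time only through such a linear bound.\<close>

lemma lftj_steps_le_of_sum_Min:
  fixes G :: "'a::linorder set set"
  assumes c: "seek_time_le c mt" and G: "simple_graph V G"
    and k: "(\<Sum>e\<in>G. Min ((\<lambda>v. card (orient G `` {v})) ` e)) \<le> k * card (orient G)"
    and m: "card (orient G) \<ge> 2"
  shows "real (lftj_steps mt (orient G)) \<le>
    2 * (35 + 6 * c) * (2 + k) * (card (orient G) * log 2 (card (orient G)))"
proof -
  let ?E = "orient G" and ?D = "\<lambda>v. card (orient G `` {v})"
  have G2: "\<forall>e\<in>G. card e = 2" using G by (simp add: simple_graph_def)
  have fin: "finite ?E" using finite_simple_graph[OF G] by (simp add: orient_def)
  have "(\<Sum>(a, b)\<in>?E. min (?D a) (?D b)) = (\<Sum>e\<in>G. min (?D (Min e)) (?D (Max e)))"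
    by (rule sum_orient[OF G2])
  also have "\<dots> = (\<Sum>e\<in>G. Min (?D ` e))"
  proof (rule sum.cong)
    fix e assume "e \<in> G"
    then have "e = {Min e, Max e}" by (rule card_2_Min_Max(1)[OF bspec[OF G2]])
    then have "Min (?D ` e) = Min (?D ` {Min e, Max e})" by (rule arg_cong)
    also have "\<dots> = min (?D (Min e)) (?D (Max e))" by simp
    finally show "min (?D (Min e)) (?D (Max e)) = Min (?D ` e)" by (rule sym)
  qed simp
  finally have eq: "(\<Sum>(a, b)\<in>?E. min (?D a) (?D b)) = (\<Sum>e\<in>G. Min (?D ` e))" .
  define M where "M = (\<Sum>e\<in>G. Min (?D ` e))"
  define m where "m = card ?E"
  define L where "L = log 2 m"
  \<comment> \<open>Two edges make the logarithm at least 1, so \<open>1 + L\<close> is absorbed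
    into \<open>2 * L\<close>.\<close>
  have "log 2 2 \<le> L" using m unfolding L_def m_def by (intro log_mono) auto
  then have L: "1 \<le> L" by simp
  have c0: "c \<ge> 0" using c by (simp add: seek_time_le_def)
  have "?E \<noteq> {}" using m by auto
  have "real (lftj_steps mt ?E) \<le> (35 + 6 * c) * (1 + L) * real (2 * m + M)"
    using lftj_steps_le[OF c fin \<open>?E \<noteq> {}\<close>] unfolding eq by (simp add: m_def L_def M_def)
  also have "\<dots> \<le> (35 + 6 * c) * (2 * L) * real (2 * m + k * m)"
    using k L c0 unfolding m_def[symmetric] M_def[symmetric]
    by (intro mult_mono of_nat_mono add_left_mono mult_nonneg_nonneg) auto
  also have "\<dots> = 2 * (35 + 6 * c) * (2 + k) * (m * L)"
    by (simp add: algebra_simps)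
  finally show ?thesis by (simp add: m_def L_def)
qed

text \<open>The layer bound is applied to the out-degree, whose sum over \<open>V\<close> is the
  number of oriented edges.\<close>

lemma planar_sum_Min_out_degree:
  assumes "simple_graph V G" "planar V G"
  shows "(\<Sum>e\<in>G. Min ((\<lambda>v. card (orient G `` {v})) ` e)) \<le> 8 * card (orient G)"
proof -
  have fin: "finite V" and G: "\<forall>e\<in>G. card e = 2" "\<forall>e\<in>G. e \<subseteq> V"
    using assms(1) by (auto simp: simple_graph_def)
  have sub: "orient G \<subseteq> V \<times> V"
    using G(2) by (fastforce simp: orient_iff[OF G(1)])
  then have "(SIGMA v:V. orient G `` {v}) = orient G" by auto
  moreover have "finite (orient G `` {v})" for v
    using finite_simple_graph[OF assms(1)] by (auto simp: orient_def intro: finite_Image)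
  ultimately have "(\<Sum>v\<in>V. card (orient G `` {v})) = card (orient G)"
    using card_SigmaI[OF fin, of "\<lambda>v. orient G `` {v}"] by simp
  then show ?thesis
    using sum_Min_le_of_sparse[OF assms(1) planar_sparse[OF assms]] by metis
qed

text \<open>One end per edge suffices to bound the minimum, since an out-degree never exceeds the
  degree.\<close>

lemma max_degree_sum_Min_out_degree:
  assumes "simple_graph V G" "max_degree_le d V G"
  shows "(\<Sum>e\<in>G. Min ((\<lambda>v. card (orient G `` {v})) ` e)) \<le> d * card (orient G)"
proof -
  have G: "\<forall>e\<in>G. card e = 2" "\<forall>e\<in>G. e \<subseteq> V"
    using assms(1) by (auto simp: simple_graph_def)
  have "Min ((\<lambda>v. card (orient G `` {v})) ` e) \<le> d" if "e \<in> G" for e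
  proof -
    have "card e = 2" using G(1) that by blast
    then have "finite e" "e \<noteq> {}" by (auto intro: card_ge_0_finite)
    then obtain v where "v \<in> e" by blast
    then have v: "v \<in> e" "v \<in> V" using bspec[OF G(2) that] by auto
    have "card (orient G `` {v}) \<le> degree G v"
      unfolding degree_def
    proof (rule card_inj_on_le)
      show "inj_on (\<lambda>w. {v, w}) (orient G `` {v})"
        by (auto simp: inj_on_def doubleton_eq_iff)
      show "(\<lambda>w. {v, w}) ` (orient G `` {v}) \<subseteq> {e \<in> G. v \<in> e}"
        by (auto simp: orient_iff[OF G(1)])
    qed (use finite_simple_graph[OF assms(1)] in simp)
    also have "\<dots> \<le> d" using assms(2) v(2) by (simp add: max_degree_le_def)
    finally show ?thesis
      using v(1) \<open>finite e\<close> by (meson Min_le finite_imageI image_eqI order_trans)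
  qed
  then have "(\<Sum>e\<in>G. Min ((\<lambda>v. card (orient G `` {v})) ` e)) \<le> card G * d"
    by (intro sum_bounded_above[where K = d, simplified]) auto
  then show ?thesis
    using card_image[OF inj_on_orient[OF G(1)]] by (simp add: orient_def mult.commute)
qed

theorem corollary18:
  fixes mt :: "'a::linorder move_time"
  assumes "efficient_iterators mt"
  shows "(\<exists>C::real. \<forall>(V :: 'a set) G. simple_graph V G \<and> planar V G \<longrightarrow>
            lists_triangles (lftj_output mt (orient G)) G \<and>
            (card (orient G) \<ge> 2 \<longrightarrow>
              real (lftj_steps mt (orient G)) \<le> C * (card (orient G) * log 2 (card (orient G)))))
       \<and> (\<forall>d. \<exists>C::real. \<forall>(V :: 'a set) G. simple_graph V G \<and> max_degree_le d V G \<longrightarrow>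
            lists_triangles (lftj_output mt (orient G)) G \<and>
            (card (orient G) \<ge> 2 \<longrightarrow>
              real (lftj_steps mt (orient G)) \<le> C * (card (orient G) * log 2 (card (orient G)))))"
proof -
  \<comment> \<open>Here \<open>c\<close> depends on \<open>mt\<close> alone, so each
    \<open>C\<close> can be fixed before \<open>V\<close> and \<open>G\<close>.\<close>
  obtain c where c: "seek_time_le c mt"
    using efficient_imp_seek_time_le[OF assms] .
  show ?thesis
  proof (intro conjI allI)
    show "\<exists>C::real. \<forall>(V :: 'a set) G. simple_graph V G \<and> planar V G \<longrightarrow>
        lists_triangles (lftj_output mt (orient G)) G \<and>
        (card (orient G) \<ge> 2 \<longrightarrow>
          real (lftj_steps mt (orient G)) \<le> C * (card (orient G) * log 2 (card (orient G))))"
      using lftj_lists_triangles lftj_steps_le_of_sum_Min[OF c _ planar_sum_Min_out_degree] by blast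
    show "\<exists>C::real. \<forall>(V :: 'a set) G. simple_graph V G \<and> max_degree_le d V G \<longrightarrow>
        lists_triangles (lftj_output mt (orient G)) G \<and>
        (card (orient G) \<ge> 2 \<longrightarrow>
          real (lftj_steps mt (orient G)) \<le> C * (card (orient G) * log 2 (card (orient G))))" for d
      using lftj_lists_triangles lftj_steps_le_of_sum_Min[OF c _ max_degree_sum_Min_out_degree] by blast
  qed
qed

end
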